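(* Let $\mathbf{H}\in\mathbb{H}^4$. The following are equivalent: (1) $\mathbf{Cov}_2(\mathbf{H})$ is orthotropic; (2) $\mathbf{H}$ is orthotropic; (3) $\mathbf{v}_5=\mathbf{v}_6=0$ and the pair $(\mathbf{d}_2,\mathbf{c}_3)$ is orthotropic. In that case the symmetry group of $\mathbf{H}$ equals the symmetry group of the triple $(\mathbf{d}_2,\mathbf{c}_3,\mathbf{c}_4)$.
   Context: $\mathbb{H}^4$ is the space of totally symmetric traceless fourth-order tensors on $\mathbb{R}^3$, with $SO(3)$-action $(g\star\mathbf{T})(x_1,\dots,x_n)=\mathbf{T}(g^{-1}x_1,\dots,g^{-1}x_n)$. $\mathbf{Cov}_2(\mathbf{H})\subset\mathrm{Sym}^2(\mathbb{R}^3)$ is the set of values at $\mathbf{H}$ of all $SO(3)$-equivariant polynomial maps $\mathbb{H}^4\to\mathrm{Sym}^2(\mathbb{R}^3)$. $(\mathbf{H}:\mathbf{H})_{ijkl}=H_{ijmn}H_{mnkl}$, $(\mathbf{H}:\mathbf{a})_{ij}=H_{ijkl}a_{kl}$, $(\operatorname{tr}_{13}\mathbf{A})_{ij}=A_{kikj}$, $\mathbf{d}_2=\operatorname{tr}_{13}(\mathbf{H}:\mathbf{H})$, $\mathbf{c}_3=\mathbf{H}:\mathbf{d}_2$, $\mathbf{c}_4=\mathbf{H}:\mathbf{c}_3$. $\mathbf{v}_5$ and $\mathbf{v}_6$ are the vectors with components $(\mathbf{v}_5)_i=\varepsilon_{ijk}(\mathbf{d}_2\mathbf{c}_3)_{jk}$,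 $(\mathbf{v}_6)_i=\varepsilon_{ijk}(\mathbf{d}_2\mathbf{c}_4)_{jk}$, where $\varepsilon$ is the Levi-Civita tensor and products of second-order tensors are matrix products. Symmetry group of a tensor: $\{g\in SO(3):g\star\mathbf{T}=\mathbf{T}\}$; of a family or subspace: intersection; symmetry class: conjugacy class. Orthotropic $=[\mathbb{D}_2]$, $\mathbb{D}_2$ the group of rotations by $\pi$ about the three coordinate axes (with identity). *)

theory Defs
  imports "HOL-Analysis.Analysis"
begin

type_synonym vec3 = "real^3"
type_synonym ten2 = "real^3^3"
type_synonym ten4 = "3 \<Rightarrow> 3 \<Rightarrow> 3 \<Rightarrow> 3 \<Rightarrow> real"

definition SO3 :: "ten2 set" where
  "SO3 = {g. orthogonal_matrix g \<and> det g = 1}"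

text \<open>Action (g*T)(x1,..,xn) = T(g^-1 x1,..,g^-1 xn), written in components
  (for g orthogonal, g^-1 = g^T).\<close>
definition act2 :: "ten2 \<Rightarrow> ten2 \<Rightarrow> ten2" where
  "act2 g a = (\<chi> i j. \<Sum>p\<in>UNIV. \<Sum>q\<in>UNIV. g$i$p * g$j$q * a$p$q)"

definition act4 :: "ten2 \<Rightarrow> ten4 \<Rightarrow> ten4" where
  "act4 g T = (\<lambda>i j k l. \<Sum>p\<in>UNIV. \<Sum>q\<in>UNIV. \<Sum>r\<in>UNIV. \<Sum>s\<in>UNIV.
      g$i$p * g$j$q * g$k$r * g$l$s * T p q r s)"

definition harm4 :: "ten4 set" where
  "harm4 = {T. (\<forall>i j k l. T i j k l = T j i k l \<and> T i j k l = T i k j l \<and> T i j k l = T i j l k)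
               \<and> (\<forall>k l. (\<Sum>i\<in>UNIV. T i i k l) = 0)}"

definition sym2set :: "ten2 set" where
  "sym2set = {a. transpose a = a}"

inductive polyfun :: "(ten4 \<Rightarrow> real) \<Rightarrow> bool" where
  pf_const: "polyfun (\<lambda>T. c)"
| pf_comp: "polyfun (\<lambda>T. T i j k l)"
| pf_add: "polyfun f \<Longrightarrow> polyfun g \<Longrightarrow> polyfun (\<lambda>T. f T + g T)"
| pf_mult: "polyfun f \<Longrightarrow> polyfun g \<Longrightarrow> polyfun (\<lambda>T. f T * g T)"

definition equiv_poly_cov2 :: "(ten4 \<Rightarrow> ten2) \<Rightarrow> bool" where
  "equiv_poly_cov2 f \<longleftrightarrow>
     (\<forall>i j. polyfun (\<lambda>T. f T $ i $ j)) \<and>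
     (\<forall>T\<in>harm4. f T \<in> sym2set) \<and>
     (\<forall>g\<in>SO3. \<forall>T\<in>harm4. f (act4 g T) = act2 g (f T))"

definition Cov2 :: "ten4 \<Rightarrow> ten2 set" where
  "Cov2 H = {f H | f. equiv_poly_cov2 f}"

definition symgrp4 :: "ten4 \<Rightarrow> ten2 set" where
  "symgrp4 T = {g\<in>SO3. act4 g T = T}"

definition symgrp2_set :: "ten2 set \<Rightarrow> ten2 set" where
  "symgrp2_set S = {g\<in>SO3. \<forall>a\<in>S. act2 g a = a}"

definition D2 :: "ten2 set" where
  "D2 = {mat 1,
         (\<chi> i j. if i = j then (if i = 1 then 1 else -1) else 0),
         (\<chi> i j. if i = j then (if i = 2 then 1 else -1) else 0),
         (\<chi> i j. if i = j then (if i = 3 then 1 else -1) else 0)}"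

definition orthotropic :: "ten2 set \<Rightarrow> bool" where
  "orthotropic G \<longleftrightarrow> (\<exists>g\<in>SO3. G = (\<lambda>h. g ** h ** transpose g) ` D2)"

definition dd :: "ten4 \<Rightarrow> ten4 \<Rightarrow> ten4" where
  "dd A B = (\<lambda>i j k l. \<Sum>m\<in>UNIV. \<Sum>n\<in>UNIV. A i j m n * B m n k l)"

definition dd2 :: "ten4 \<Rightarrow> ten2 \<Rightarrow> ten2" where
  "dd2 A a = (\<chi> i j. \<Sum>k\<in>UNIV. \<Sum>l\<in>UNIV. A i j k l * a$k$l)"

definition tr13 :: "ten4 \<Rightarrow> ten2" where
  "tr13 A = (\<chi> i j. \<Sum>k\<in>UNIV. A k i k j)"

definition d2 :: "ten4 \<Rightarrow> ten2" where "d2 H = tr13 (dd H H)"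
definition c3 :: "ten4 \<Rightarrow> ten2" where "c3 H = dd2 H (d2 H)"
definition c4 :: "ten4 \<Rightarrow> ten2" where "c4 H = dd2 H (c3 H)"

definition levi_civita :: "3 \<Rightarrow> 3 \<Rightarrow> 3 \<Rightarrow> real" where
  "levi_civita i j k =
     (if (i,j,k) \<in> {(1,2,3),(2,3,1),(3,1,2)} then 1
      else if (i,j,k) \<in> {(1,3,2),(3,2,1),(2,1,3)} then -1 else 0)"

definition axial :: "ten2 \<Rightarrow> vec3" where
  "axial a = (\<chi> i. \<Sum>j\<in>UNIV. \<Sum>k\<in>UNIV. levi_civita i j k * a$j$k)"

definition v5 :: "ten4 \<Rightarrow> vec3" where "v5 H = axial (d2 H ** c3 H)"
definition v6 :: "ten4 \<Rightarrow> vec3" where "v6 H = axial (d2 H ** c4 H)"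

end

theory Submission
  imports Defs
begin

text \<open>
  All objects are equivariant, so the orthotropic group in question may be taken to be \<^const>\<open>D2\<close>.
  Let \<open>s\<^sup>i\<^sup>j\<close> be the vector with components \<open>H\<^sub>i\<^sub>j\<^sub>k\<^sub>k\<close>. Then \<open>H\<close> is invariant under \<^const>\<open>D2\<close> iff
  \<open>s\<^sup>i\<^sup>j = 0\<close> whenever \<open>i \<noteq> j\<close>.

  (1) implies (2): \<open>Cov2 H\<close> contains the identity and is closed under the Jordan product and under
  \<open>a \<mapsto> H:a\<close>. If its symmetry group is \<^const>\<open>D2\<close>, it consists of diagonal matrices and separates the
  three diagonal positions, so it contains all diagonal matrices; hence \<open>H\<close> maps diagonal matrices
  to diagonal matrices.

  (2) implies (3): \<open>H\<close> depends on \<open>a = H\<^sub>2\<^sub>2\<^sub>3\<^sub>3\<close>, \<open>b = H\<^sub>1\<^sub>1\<^sub>3\<^sub>3\<close>, \<open>c = H\<^sub>1\<^sub>1\<^sub>2\<^sub>2\<close>, which are pairwise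
  distinct since otherwise a rotation exchanging two axes fixes \<open>H\<close>; a computation then shows that
  \<open>d2\<close> and \<open>c3\<close> together separate the three axes. Since \<open>d2\<close>, \<open>c3\<close>, \<open>c4\<close> are simultaneously
  diagonal, they commute, which is what \<open>v5 = v6 = 0\<close> means.

  (3) implies (2): let \<open>D\<close> and \<open>C\<close> be the diagonals of \<open>d2\<close> and \<open>c3\<close>. For \<open>i \<noteq> j\<close> the vector \<open>s\<^sup>i\<^sup>j\<close> is
  orthogonal to \<open>1 = (1,1,1)\<close> and \<open>D\<close>, and to \<open>C\<close> if \<open>D\<^sub>i \<noteq> D\<^sub>j\<close>. The only hard case is that of three
  distinct \<open>D\<^sub>i\<close> with \<open>C\<close> in the span of \<open>1\<close> and \<open>D\<close>. There \<open>s\<^sup>i\<^sup>j = t\<^sub>k (D \<times> 1)\<close> for cyclic \<open>(i,j,k)\<close>,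
  and \<open>H\<^sub>i\<^sub>i\<^sub>j\<^sub>j\<close> is a quadratic function of the deviatoric part of \<open>D\<^sub>k\<close>. The entries of \<open>d2\<close> then become
  polynomials divisible by \<open>D\<^sub>i - D\<^sub>j\<close>; the quotients give polynomial equations for \<open>t\<close>, which have no
  solution with exactly one or with three nonzero \<open>t\<^sub>k\<close>, and two nonzero \<open>t\<^sub>k\<close> force the third.
\<close>

section \<open>Equivariance\<close>

definition contr :: "real^'n^'m \<Rightarrow> 'm \<Rightarrow> ('n \<Rightarrow> real) \<Rightarrow> real" where
  "contr g i X = (\<Sum>p\<in>UNIV. g$i$p * X p)"

lemma contr_swap: "contr g i (\<lambda>p. contr h j (\<lambda>q. X p q)) = contr h j (\<lambda>q. contr g i (\<lambda>p. X p q))"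
  unfolding contr_def sum_distrib_left by (subst sum.swap) (simp add: mult.left_commute)

lemma contr_contr: "contr g i (\<lambda>p. contr h p X) = contr (g ** h) i X"
  unfolding contr_def sum_distrib_left matrix_matrix_mult_def
  by (subst sum.swap) (simp add: sum_distrib_right mult.assoc)

lemma contr_mult_right: "contr g i X * c = contr g i (\<lambda>p. X p * c)"
  by (simp add: contr_def sum_distrib_right mult.assoc)

lemma contr_mult_left: "c * contr g i X = contr g i (\<lambda>p. c * X p)"
  by (simp add: contr_def sum_distrib_left mult.left_commute)

lemma contr_sum: "(\<Sum>r\<in>A. contr g i (\<lambda>p. X p r)) = contr g i (\<lambda>p. \<Sum>r\<in>A. X p r)"
  unfolding contr_def sum_distrib_left by (rule sum.swap)

definition diagonal :: "real^'n^'n \<Rightarrow> bool" where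
  "diagonal a \<longleftrightarrow> (\<forall>i j. i \<noteq> j \<longrightarrow> a$i$j = 0)"

lemma contr_diagonal:
  assumes "diagonal g"
  shows "contr g i X = g$i$i * X i"
proof -
  have "contr g i X = (\<Sum>p\<in>UNIV. if p = i then g$i$i * X i else 0)"
    unfolding contr_def by (rule sum.cong) (use assms in \<open>auto simp: diagonal_def\<close>)
  then show ?thesis by simp
qed

lemma diagonal_mat: "diagonal (mat c)"
  by (simp add: diagonal_def mat_def)

lemma contr_mat_1: "contr (mat 1) i X = X i"
  by (simp add: contr_diagonal diagonal_mat) (simp add: mat_def)

lemma contr_contr_eq_matrix_mult:
  "contr g i (\<lambda>p. contr h j (\<lambda>q. X p q)) = (g ** (\<chi> p q. X p q) ** transpose h) $ i $ j"
  unfolding contr_swap[of g]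
  by (simp add: contr_def matrix_matrix_mult_def transpose_def mult.commute)

lemma contr_trace:
  fixes g :: "real^'n^'n"
  assumes "orthogonal_matrix g"
  shows "(\<Sum>i\<in>UNIV. contr g i (\<lambda>p. contr g i (\<lambda>q. X p q))) = (\<Sum>p\<in>UNIV. X p p)"
proof -
  have "trace (g ** (\<chi> p q. X p q) ** transpose g) = trace (transpose g ** (g ** (\<chi> p q. X p q)))"
    by (rule trace_mul_sym)
  also have "\<dots> = trace (\<chi> p q. X p q)"
    using assms by (simp add: matrix_mul_assoc orthogonal_matrix_def)
  finally show ?thesis
    by (simp add: contr_contr_eq_matrix_mult trace_def)
qed

lemma contr_orthogonal:
  fixes g :: "real^'n^'n"
  assumes "orthogonal_matrix g"
  shows "(\<Sum>k\<in>UNIV. contr g k X * contr g k Y) = (\<Sum>r\<in>UNIV. X r * Y r)"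
  using contr_trace[OF assms, of "\<lambda>p q. X p * Y q"]
  by (simp add: contr_mult_left[symmetric] contr_mult_right[symmetric])

lemma contr_orthogonal_sum:
  fixes g :: "real^'n^'n"
  assumes "orthogonal_matrix g"
  shows "(\<Sum>k\<in>UNIV. \<Sum>z\<in>A. contr g k (\<lambda>r. X r z) * contr g k (\<lambda>r. Y r z))
       = (\<Sum>r\<in>UNIV. \<Sum>z\<in>A. X r z * Y r z)"
  by (subst sum.swap) (simp only: contr_orthogonal[OF assms] sum.swap[of _ A])

lemma contr_orthogonal2:
  fixes g :: "real^'n^'n"
  assumes "orthogonal_matrix g"
  shows "(\<Sum>k\<in>UNIV. \<Sum>l\<in>UNIV. contr g k (\<lambda>r. contr g l (\<lambda>s. X r s)) * contr g k (\<lambda>r. contr g l (\<lambda>s. Y r s)))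
       = (\<Sum>r\<in>UNIV. \<Sum>s\<in>UNIV. X r s * Y r s)"
  by (simp only: contr_orthogonal_sum[OF assms] contr_orthogonal[OF assms])

lemma contr_orthogonal3:
  fixes g :: "real^'n^'n"
  assumes "orthogonal_matrix g"
  shows "(\<Sum>k\<in>UNIV. \<Sum>m\<in>UNIV. \<Sum>n\<in>UNIV.
            contr g k (\<lambda>q. contr g m (\<lambda>r. contr g n (\<lambda>s. X q r s))) *
            contr g k (\<lambda>q. contr g m (\<lambda>r. contr g n (\<lambda>s. Y q r s))))
       = (\<Sum>q\<in>UNIV. \<Sum>r\<in>UNIV. \<Sum>s\<in>UNIV. X q r s * Y q r s)"
  using contr_orthogonal_sum[OF assms, of "\<lambda>q z. contr g (fst z) (\<lambda>r. contr g (snd z) (\<lambda>s. X q r s))"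
      "\<lambda>q z. contr g (fst z) (\<lambda>r. contr g (snd z) (\<lambda>s. Y q r s))" UNIV]
  by (simp add: contr_orthogonal2[OF assms] sum.cartesian_product' flip: UNIV_Times_UNIV)

lemma act2_contr: "act2 g a $ i $ j = contr g i (\<lambda>p. contr g j (\<lambda>q. a$p$q))"
  by (simp add: act2_def contr_def sum_distrib_left mult.assoc)

lemma act2_eq_matrix_mult: "act2 g a = g ** a ** transpose g"
  by (simp add: vec_eq_iff act2_contr contr_contr_eq_matrix_mult)

lemma act4_contr:
  "act4 g T i j k l = contr g i (\<lambda>p. contr g j (\<lambda>q. contr g k (\<lambda>r. contr g l (\<lambda>s. T p q r s))))"
  by (simp add: act4_def contr_def sum_distrib_left mult.assoc)

lemma act4_mult: "act4 (g ** h) T = act4 g (act4 h T)"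
  by (intro ext) (simp only: act4_contr contr_swap[of g _ h] contr_contr)

lemma act4_mat_1: "act4 (mat 1) T = T"
  by (intro ext) (simp only: act4_contr contr_mat_1)

lemma act4_swap:
  "act4 g (\<lambda>p q r s. T q p r s) i j k l = act4 g T j i k l"
  "act4 g (\<lambda>p q r s. T p r q s) i j k l = act4 g T i k j l"
  "act4 g (\<lambda>p q r s. T p q s r) i j k l = act4 g T i j l k"
  unfolding act4_contr
  by (rule contr_swap, subst contr_swap[of g j g k], rule refl, subst contr_swap[of g k g l], rule refl)

lemma harm4_sym:
  assumes "T \<in> harm4"
  shows "T i j k l = T j i k l" "T i j k l = T i k j l" "T i j k l = T i j l k"
  using assms by (auto simp: harm4_def)

lemma harm4_trace: "T \<in> harm4 \<Longrightarrow> (\<Sum>i\<in>UNIV. T i i k l) = 0"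
  by (simp add: harm4_def)

lemma act4_harm4:
  assumes "orthogonal_matrix g" "T \<in> harm4"
  shows "act4 g T \<in> harm4"
proof -
  have "(\<lambda>p q r s. T q p r s) = T" "(\<lambda>p q r s. T p r q s) = T" "(\<lambda>p q r s. T p q s r) = T"
    by (intro ext, rule harm4_sym[OF assms(2)])+
  note symmetric = act4_swap[of g T, unfolded this]
  have "(\<Sum>i\<in>UNIV. act4 g T i i k l) = 0" for k l
  proof -
    have "(\<Sum>i\<in>UNIV. act4 g T i i k l) = (\<Sum>p\<in>UNIV. contr g k (\<lambda>r. contr g l (\<lambda>s. T p p r s)))"
      unfolding act4_contr by (rule contr_trace[OF assms(1)])
    also have "\<dots> = 0"
      by (simp add: contr_sum harm4_trace[OF assms(2)]) (simp add: contr_def)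
    finally show ?thesis .
  qed
  then show ?thesis
    unfolding harm4_def using symmetric by blast
qed

lemma dd2_equivariant:
  assumes "orthogonal_matrix g"
  shows "dd2 (act4 g T) (act2 g a) = act2 g (dd2 T a)"
proof -
  have "dd2 (act4 g T) (act2 g a) $ i $ j = act2 g (dd2 T a) $ i $ j" for i j
  proof -
    define X where "X r s = contr g i (\<lambda>p. contr g j (\<lambda>q. T p q r s))" for r s
    have "act4 g T i j k l = contr g k (\<lambda>r. contr g l (\<lambda>s. X r s))" for k l
      unfolding act4_contr X_def
      by (simp only: contr_swap[of g j g k] contr_swap[of g i g k] contr_swap[of g j g l] contr_swap[of g i g l])
    then have "dd2 (act4 g T) (act2 g a) $ i $ j = (\<Sum>r\<in>UNIV. \<Sum>s\<in>UNIV. X r s * a$r$s)"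
      by (simp add: dd2_def act2_contr contr_orthogonal2[OF assms])
    also have "\<dots> = act2 g (dd2 T a) $ i $ j"
      by (simp add: X_def act2_contr dd2_def contr_mult_right contr_sum)
    finally show ?thesis .
  qed
  then show ?thesis by (simp add: vec_eq_iff)
qed

lemma d2_harm4:
  assumes "T \<in> harm4"
  shows "d2 T $ i $ j = (\<Sum>k\<in>UNIV. \<Sum>m\<in>UNIV. \<Sum>n\<in>UNIV. T i k m n * T j k m n)"
proof -
  have "T k i m n = T i k m n" "T m n k j = T j k m n" for k m n
    by (metis harm4_sym[OF assms])+
  then show ?thesis by (simp add: d2_def tr13_def dd_def)
qed

lemma d2_equivariant:
  assumes g: "orthogonal_matrix g" and T: "T \<in> harm4"
  shows "d2 (act4 g T) = act2 g (d2 T)"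
proof -
  have "d2 (act4 g T) $ i $ j = act2 g (d2 T) $ i $ j" for i j
  proof -
    define X where "X i q r s = contr g i (\<lambda>p. T p q r s)" for i q r s
    have "act4 g T i k m n = contr g k (\<lambda>q. contr g m (\<lambda>r. contr g n (\<lambda>s. X i q r s)))" for i k m n
      unfolding act4_contr X_def
      by (simp only: contr_swap[of g i g k] contr_swap[of g i g m] contr_swap[of g i g n])
    then have "d2 (act4 g T) $ i $ j = (\<Sum>q\<in>UNIV. \<Sum>r\<in>UNIV. \<Sum>s\<in>UNIV. X i q r s * X j q r s)"
      by (simp add: d2_harm4[OF act4_harm4[OF g T]] contr_orthogonal3[OF g])
    also have "\<dots> = (\<Sum>q\<in>UNIV. \<Sum>r\<in>UNIV. \<Sum>s\<in>UNIV.
        contr g i (\<lambda>p. contr g j (\<lambda>p'. T p q r s * T p' q r s)))"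
      by (simp only: X_def contr_mult_right contr_mult_left contr_swap[of g i g j])
    also have "\<dots> = act2 g (d2 T) $ i $ j"
      by (simp only: act2_contr d2_harm4[OF T] contr_sum)
    finally show ?thesis .
  qed
  then show ?thesis by (simp add: vec_eq_iff)
qed

lemma c3_equivariant:
  "orthogonal_matrix g \<Longrightarrow> T \<in> harm4 \<Longrightarrow> c3 (act4 g T) = act2 g (c3 T)"
  by (simp add: c3_def d2_equivariant dd2_equivariant)

lemma c4_equivariant:
  "orthogonal_matrix g \<Longrightarrow> T \<in> harm4 \<Longrightarrow> c4 (act4 g T) = act2 g (c4 T)"
  by (simp add: c4_def c3_equivariant dd2_equivariant)

lemma d2_sym: "T \<in> harm4 \<Longrightarrow> d2 T \<in> sym2set"
  by (simp add: sym2set_def vec_eq_iff transpose_def d2_harm4 mult.commute)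

lemma dd2_sym:
  assumes "T \<in> harm4"
  shows "dd2 T a \<in> sym2set"
proof -
  have "dd2 T a $ j $ i = dd2 T a $ i $ j" for i j
    using harm4_sym(1)[OF assms, of i j] by (simp add: dd2_def)
  then show ?thesis by (simp add: sym2set_def vec_eq_iff transpose_def)
qed

lemma SO3_orthogonal: "g \<in> SO3 \<Longrightarrow> orthogonal_matrix g"
  by (simp add: SO3_def)

lemma SO3_transpose: "g \<in> SO3 \<Longrightarrow> transpose g \<in> SO3"
  by (simp add: SO3_def orthogonal_matrix_transpose)

lemma SO3_mult: "g \<in> SO3 \<Longrightarrow> h \<in> SO3 \<Longrightarrow> g ** h \<in> SO3"
  by (simp add: SO3_def orthogonal_matrix_mul det_mul)

lemma SO3_cancel:
  assumes "g \<in> SO3"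
  shows "g ** transpose g = mat 1" "transpose g ** g = mat 1"
  using assms by (auto simp: SO3_def orthogonal_matrix_def)

lemma act2_add: "act2 g (a + b) = act2 g a + act2 g b"
  by (simp add: vec_eq_iff act2_def algebra_simps sum.distrib)

lemma act2_scaleR: "act2 g (c *\<^sub>R a) = c *\<^sub>R act2 g a"
  by (simp add: vec_eq_iff act2_def algebra_simps sum_distrib_left)

lemma act2_mat_1: "act2 (mat 1) a = a"
  by (simp add: act2_eq_matrix_mult)

lemma act2_mult: "act2 (g ** h) a = act2 g (act2 h a)"
  by (simp add: act2_eq_matrix_mult matrix_mul_assoc matrix_transpose_mul)

lemma act2_matrix_mult:
  assumes "g \<in> SO3"
  shows "act2 g (a ** b) = act2 g a ** act2 g b"
proof -
  have "act2 g a ** act2 g b = g ** a ** (transpose g ** g) ** b ** transpose g"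
    by (simp add: act2_eq_matrix_mult matrix_mul_assoc)
  then show ?thesis
    by (simp add: SO3_cancel[OF assms] act2_eq_matrix_mult matrix_mul_assoc)
qed

section \<open>Covariants of order two\<close>

lemma polyfun_sum:
  assumes "finite A" "\<And>x. x \<in> A \<Longrightarrow> polyfun (f x)"
  shows "polyfun (\<lambda>T. \<Sum>x\<in>A. f x T)"
  using assms by (induction A) (auto intro: polyfun.intros)

lemma equiv_poly_cov2_mat_1: "equiv_poly_cov2 (\<lambda>T. mat 1)"
  by (auto simp: equiv_poly_cov2_def sym2set_def act2_eq_matrix_mult SO3_cancel intro: polyfun.intros)

lemma equiv_poly_cov2_add:
  assumes "equiv_poly_cov2 f" "equiv_poly_cov2 h"
  shows "equiv_poly_cov2 (\<lambda>T. f T + h T)"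
  using assms
  by (auto simp: equiv_poly_cov2_def sym2set_def act2_add transpose_def vec_eq_iff intro: polyfun.intros)

lemma equiv_poly_cov2_scaleR:
  assumes "equiv_poly_cov2 f"
  shows "equiv_poly_cov2 (\<lambda>T. c *\<^sub>R f T)"
  using assms
  by (auto simp: equiv_poly_cov2_def sym2set_def act2_scaleR transpose_def vec_eq_iff intro: polyfun.intros)

lemma equiv_poly_cov2_jordan:
  assumes "equiv_poly_cov2 f" "equiv_poly_cov2 h"
  shows "equiv_poly_cov2 (\<lambda>T. f T ** h T + h T ** f T)"
proof -
  have "polyfun (\<lambda>T. (f T ** h T + h T ** f T) $ i $ j)" for i j
    using assms
    by (auto simp: equiv_poly_cov2_def matrix_matrix_mult_def intro!: polyfun.intros polyfun_sum)
  moreover have "a ** b + b ** a \<in> sym2set" if "a \<in> sym2set" "b \<in> sym2set" for a b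
  proof -
    have "transpose (a ** b + b ** a) = transpose (a ** b) + transpose (b ** a)"
      by (simp add: transpose_def vec_eq_iff)
    then show ?thesis using that by (simp add: sym2set_def matrix_transpose_mul)
  qed
  ultimately show ?thesis
    using assms by (auto simp: equiv_poly_cov2_def act2_add act2_matrix_mult)
qed

lemma equiv_poly_cov2_dd2:
  assumes "equiv_poly_cov2 f"
  shows "equiv_poly_cov2 (\<lambda>T. dd2 T (f T))"
proof -
  have "polyfun (\<lambda>T. dd2 T (f T) $ i $ j)" for i j
    using assms by (auto simp: equiv_poly_cov2_def dd2_def intro!: polyfun.intros polyfun_sum)
  then show ?thesis
    using assms by (auto simp: equiv_poly_cov2_def dd2_sym dd2_equivariant SO3_orthogonal)
qed

lemma equiv_poly_cov2_d2: "equiv_poly_cov2 d2"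
proof -
  have "polyfun (\<lambda>T. d2 T $ i $ j)" for i j
    by (auto simp: d2_def tr13_def dd_def intro!: polyfun.intros polyfun_sum)
  then show ?thesis
    by (auto simp: equiv_poly_cov2_def d2_sym d2_equivariant SO3_orthogonal)
qed

lemma Cov2_mat_1: "mat 1 \<in> Cov2 H"
  using equiv_poly_cov2_mat_1 by (auto simp: Cov2_def)

lemma Cov2_add: "a \<in> Cov2 H \<Longrightarrow> b \<in> Cov2 H \<Longrightarrow> a + b \<in> Cov2 H"
  unfolding Cov2_def by (fast intro: equiv_poly_cov2_add)

lemma Cov2_scaleR: "a \<in> Cov2 H \<Longrightarrow> c *\<^sub>R a \<in> Cov2 H"
  unfolding Cov2_def by (fast intro: equiv_poly_cov2_scaleR)

lemma Cov2_jordan: "a \<in> Cov2 H \<Longrightarrow> b \<in> Cov2 H \<Longrightarrow> a ** b + b ** a \<in> Cov2 H"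
  unfolding Cov2_def by (fast intro: equiv_poly_cov2_jordan)

lemma Cov2_dd2: "a \<in> Cov2 H \<Longrightarrow> dd2 H a \<in> Cov2 H"
  unfolding Cov2_def by (fast intro: equiv_poly_cov2_dd2)

lemma d2_in_Cov2: "d2 H \<in> Cov2 H"
  using equiv_poly_cov2_d2 by (auto simp: Cov2_def)

lemma c3_in_Cov2: "c3 H \<in> Cov2 H"
  unfolding c3_def by (intro Cov2_dd2 d2_in_Cov2)

lemma c4_in_Cov2: "c4 H \<in> Cov2 H"
  unfolding c4_def by (intro Cov2_dd2 c3_in_Cov2)

lemma Cov2_act4:
  assumes "g \<in> SO3" "H \<in> harm4"
  shows "Cov2 (act4 g H) = act2 g ` Cov2 H"
proof -
  have "f (act4 g H) = act2 g (f H)" if "equiv_poly_cov2 f" for f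
    using that assms by (simp add: equiv_poly_cov2_def)
  then show ?thesis
    unfolding Cov2_def by auto
qed

lemma symgrp2_set_antimono: "S \<subseteq> S' \<Longrightarrow> symgrp2_set S' \<subseteq> symgrp2_set S"
  by (auto simp: symgrp2_set_def)

lemma symgrp4_subset_symgrp2_set:
  assumes "H \<in> harm4" "S \<subseteq> Cov2 H"
  shows "symgrp4 H \<subseteq> symgrp2_set S"
proof -
  have "act2 g (f H) = f H" if "g \<in> SO3" "act4 g H = H" "equiv_poly_cov2 f" for g f
    using that assms(1) by (metis equiv_poly_cov2_def)
  then show ?thesis
    using assms(2) by (auto simp: symgrp4_def symgrp2_set_def Cov2_def)
qed

section \<open>Change of frame\<close>

lemma act2_SO3: "g \<in> SO3 \<Longrightarrow> h \<in> SO3 \<Longrightarrow> act2 g h \<in> SO3"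
  by (simp add: act2_eq_matrix_mult SO3_mult SO3_transpose)

lemma act2_inverse:
  assumes "g \<in> SO3"
  shows "act2 (transpose g) (act2 g a) = a" "act2 g (act2 (transpose g) a) = a"
  using SO3_cancel[OF assms] by (simp_all add: act2_mult[symmetric] act2_mat_1)

lemma act4_inverse:
  assumes "g \<in> SO3"
  shows "act4 (transpose g) (act4 g T) = T"
  using SO3_cancel[OF assms] by (simp add: act4_mult[symmetric] act4_mat_1)

lemma inj_act2: "g \<in> SO3 \<Longrightarrow> inj (act2 g)"
  by (metis act2_inverse(1) injI)

lemma inj_act4: "g \<in> SO3 \<Longrightarrow> inj (act4 g)"
  by (metis act4_inverse injI)

lemma act2_eq_self_iff:
  assumes "g \<in> SO3"
  shows "act2 g a = a \<longleftrightarrow> g ** a = a ** g"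
proof
  assume "act2 g a = a"
  then have "a ** g = g ** a ** (transpose g ** g)"
    by (simp add: act2_eq_matrix_mult matrix_mul_assoc)
  then show "g ** a = a ** g"
    by (simp add: SO3_cancel[OF assms])
next
  assume "g ** a = a ** g"
  then have "act2 g a = a ** (g ** transpose g)"
    by (simp add: act2_eq_matrix_mult matrix_mul_assoc)
  then show "act2 g a = a"
    by (simp add: SO3_cancel[OF assms])
qed

lemma act2_commute_iff:
  assumes "g \<in> SO3"
  shows "act2 g a ** act2 g b = act2 g b ** act2 g a \<longleftrightarrow> a ** b = b ** a"
  by (simp add: act2_matrix_mult[OF assms, symmetric] inj_eq[OF inj_act2[OF assms]])

lemma image_act2_eqI:
  assumes g: "g \<in> SO3" and sub: "A \<subseteq> SO3" "B \<subseteq> SO3"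
    and iff: "\<And>h. h \<in> SO3 \<Longrightarrow> act2 g h \<in> B \<longleftrightarrow> h \<in> A"
  shows "B = act2 g ` A"
proof
  show "act2 g ` A \<subseteq> B" using sub iff by blast
  show "B \<subseteq> act2 g ` A"
  proof
    fix k assume k: "k \<in> B"
    then have "act2 (transpose g) k \<in> A"
      using iff[of "act2 (transpose g) k"] sub g by (auto simp: act2_SO3 SO3_transpose act2_inverse)
    then show "k \<in> act2 g ` A"
      by (rule rev_image_eqI) (simp add: act2_inverse g)
  qed
qed

lemma symgrp4_act4:
  assumes "g \<in> SO3"
  shows "symgrp4 (act4 g H) = act2 g ` symgrp4 H"
proof (rule image_act2_eqI[OF assms])
  fix h assume h: "h \<in> SO3"
  have "act2 g h ** g = g ** h ** (transpose g ** g)"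
    by (simp add: act2_eq_matrix_mult matrix_mul_assoc)
  then have "act4 (act2 g h) (act4 g H) = act4 g (act4 h H)"
    by (simp add: SO3_cancel[OF assms] flip: act4_mult)
  then show "act2 g h \<in> symgrp4 (act4 g H) \<longleftrightarrow> h \<in> symgrp4 H"
    using assms h by (simp add: symgrp4_def act2_SO3 inj_eq[OF inj_act4])
qed (auto simp: symgrp4_def)

lemma symgrp2_set_act2:
  assumes "g \<in> SO3"
  shows "symgrp2_set (act2 g ` S) = act2 g ` symgrp2_set S"
proof (rule image_act2_eqI[OF assms])
  fix h assume "h \<in> SO3"
  then show "act2 g h \<in> symgrp2_set (act2 g ` S) \<longleftrightarrow> h \<in> symgrp2_set S"
    using assms by (simp add: symgrp2_set_def act2_SO3 act2_eq_self_iff act2_commute_iff)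
qed (auto simp: symgrp2_set_def)

lemma orthotropic_iff_act2: "orthotropic G \<longleftrightarrow> (\<exists>g\<in>SO3. G = act2 g ` D2)"
  by (simp add: orthotropic_def act2_eq_matrix_mult[abs_def])

lemma orthotropic_frame:
  assumes "orthotropic G"
  obtains g where "g \<in> SO3" "act2 g ` G = D2"
proof -
  obtain g where g: "g \<in> SO3" "G = act2 g ` D2"
    using assms by (auto simp: orthotropic_iff_act2)
  have "act2 (transpose g) ` G = D2"
    by (simp add: g image_image act2_inverse)
  then show ?thesis using that g(1) SO3_transpose by blast
qed

definition frame_equivariant :: "(ten4 \<Rightarrow> ten2 set) \<Rightarrow> bool" where
  "frame_equivariant F \<longleftrightarrow> (\<forall>g\<in>SO3. \<forall>T\<in>harm4. F (act4 g T) = act2 g ` F T)"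

lemma frame_equivariant_symgrp4: "frame_equivariant symgrp4"
  by (simp add: frame_equivariant_def symgrp4_act4)

lemma frame_equivariant_symgrp2_set:
  "frame_equivariant S \<Longrightarrow> frame_equivariant (\<lambda>T. symgrp2_set (S T))"
  by (simp add: frame_equivariant_def symgrp2_set_act2)

lemma frame_equivariant_Cov2: "frame_equivariant Cov2"
  by (simp add: frame_equivariant_def Cov2_act4)

lemma frame_equivariant_d2_c3: "frame_equivariant (\<lambda>T. {d2 T, c3 T})"
  by (simp add: frame_equivariant_def d2_equivariant c3_equivariant SO3_orthogonal)

lemma orthotropic_imp_eq_in_frame:
  assumes F: "frame_equivariant F" and G: "frame_equivariant G" and H: "H \<in> harm4"
    and "orthotropic (F H)"
    and standard_frame: "\<And>g. g \<in> SO3 \<Longrightarrow> F (act4 g H) = D2 \<Longrightarrow> G (act4 g H) = D2"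
  shows "G H = F H"
proof -
  obtain g where g: "g \<in> SO3" "act2 g ` F H = D2"
    using \<open>orthotropic (F H)\<close> by (rule orthotropic_frame)
  have "F (act4 g H) = D2"
    using F H g by (simp add: frame_equivariant_def)
  then have "G (act4 g H) = D2"
    using standard_frame g(1) by blast
  then have "act2 g ` G H = act2 g ` F H"
    using G H g by (simp add: frame_equivariant_def)
  then show ?thesis
    by (simp only: inj_image_eq_iff[OF inj_act2[OF g(1)]])
qed

lemma axial_eq_0_iff: "axial m = 0 \<longleftrightarrow> transpose m = m"
  by (auto simp: axial_def levi_civita_def vec_eq_iff transpose_def forall_3 sum_3)

lemma axial_matrix_mult_eq_0_iff:
  assumes "a \<in> sym2set" "b \<in> sym2set"
  shows "axial (a ** b) = 0 \<longleftrightarrow> a ** b = b ** a"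
  using assms by (auto simp: axial_eq_0_iff matrix_transpose_mul sym2set_def)

lemma v5_eq_0_iff: "H \<in> harm4 \<Longrightarrow> v5 H = 0 \<longleftrightarrow> d2 H ** c3 H = c3 H ** d2 H"
  by (simp add: v5_def axial_matrix_mult_eq_0_iff d2_sym dd2_sym c3_def)

lemma v6_eq_0_iff: "H \<in> harm4 \<Longrightarrow> v6 H = 0 \<longleftrightarrow> d2 H ** c4 H = c4 H ** d2 H"
  by (simp add: v6_def axial_matrix_mult_eq_0_iff d2_sym dd2_sym c4_def)

lemma v6_act4_eq_0_iff:
  assumes "g \<in> SO3" "H \<in> harm4"
  shows "v6 (act4 g H) = 0 \<longleftrightarrow> v6 H = 0"
  using assms
  by (simp add: v6_eq_0_iff act4_harm4 SO3_orthogonal d2_equivariant c4_equivariant act2_commute_iff)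

section \<open>Diagonal tensors\<close>

lemma UNIV_eq_distinct_3:
  fixes i j k :: 3
  assumes "distinct [i, j, k]"
  shows "UNIV = {i, j, k}"
  using assms exhaust_3[of i] exhaust_3[of j] exhaust_3[of k] by (auto simp: UNIV_3)

lemma sum_distinct_3:
  fixes i j k :: 3
  assumes "distinct [i, j, k]"
  shows "sum f UNIV = f i + f j + f k"
  using assms by (simp add: UNIV_eq_distinct_3[OF assms] add.assoc)

lemma all_distinct_3:
  fixes i j k :: 3
  assumes "distinct [i, j, k]"
  shows "(\<forall>l. P l) \<longleftrightarrow> P i \<and> P j \<and> P k"
  using UNIV_eq_distinct_3[OF assms] by (metis UNIV_I insertE singletonD)

lemma obtain_third_index:
  fixes i j :: 3
  assumes "i \<noteq> j"
  obtains k where "distinct [i, j, k]"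
proof -
  have "card {i, j} < CARD(3)" by (simp add: assms)
  then obtain k where "k \<notin> {i, j}"
    by (metis UNIV_eq_I less_irrefl)
  then show ?thesis using that[of k] assms by auto
qed

lemma diagonal_mult_left: "diagonal a \<Longrightarrow> (a ** b) $ i $ j = a$i$i * b$i$j"
  using contr_diagonal[of a i "\<lambda>k. b$k$j"] by (simp add: matrix_matrix_mult_def contr_def)

lemma diagonal_transpose: "diagonal a \<Longrightarrow> transpose a = a"
  by (auto simp: diagonal_def transpose_def vec_eq_iff) metis

lemma diagonal_mult_right:
  assumes "diagonal b"
  shows "(a ** b) $ i $ j = a$i$j * b$j$j"
proof -
  have "a ** b = transpose (b ** transpose a)"
    by (simp add: matrix_transpose_mul diagonal_transpose[OF assms])
  then show ?thesis
    by (simp add: transpose_def diagonal_mult_left[OF assms])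
qed

lemma diagonal_commute:
  assumes "diagonal a" "diagonal b"
  shows "a ** b = b ** a"
proof -
  have "a$i$i * b$i$j = b$i$i * a$i$j" for i j
    using assms by (cases "i = j") (auto simp: diagonal_def)
  then show ?thesis
    using assms by (simp add: vec_eq_iff diagonal_mult_left)
qed

definition half_turn :: "3 \<Rightarrow> ten2" where
  "half_turn i = (\<chi> p q. if p = q then (if p = i then 1 else -1) else 0)"

lemma half_turn_in_D2: "half_turn i \<in> D2"
  using exhaust_3[of i] by (auto simp: D2_def half_turn_def)

lemma D2_iff_diagonal: "g \<in> D2 \<longleftrightarrow> g \<in> SO3 \<and> diagonal g"
proof
  show "g \<in> D2 \<Longrightarrow> g \<in> SO3 \<and> diagonal g"
    by (auto simp: D2_def SO3_def diagonal_def orthogonal_matrix_def vec_eq_iff forall_3 sum_3 det_3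
        matrix_matrix_mult_def transpose_def mat_def)
  assume g: "g \<in> SO3 \<and> diagonal g"
  then have off: "g$1$2 = 0" "g$2$1 = 0" "g$1$3 = 0" "g$3$1 = 0" "g$2$3 = 0" "g$3$2 = 0"
    by (auto simp: diagonal_def)
  have "g ** transpose g = mat 1" "det g = 1" using g by (auto simp: SO3_def orthogonal_matrix_def)
  then have "g$1$1*g$1$1 = 1" "g$2$2*g$2$2 = 1" "g$3$3*g$3$3 = 1" "g$1$1*g$2$2*g$3$3 = 1"
    by (auto simp: vec_eq_iff forall_3 sum_3 det_3 matrix_matrix_mult_def transpose_def mat_def off)
  then have "(g$1$1 = 1 \<and> g$2$2 = 1 \<and> g$3$3 = 1) \<or> (g$1$1 = 1 \<and> g$2$2 = -1 \<and> g$3$3 = -1)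
      \<or> (g$1$1 = -1 \<and> g$2$2 = 1 \<and> g$3$3 = -1) \<or> (g$1$1 = -1 \<and> g$2$2 = -1 \<and> g$3$3 = 1)"
    by (auto simp: square_eq_1_iff)
  then show "g \<in> D2"
    by (auto simp: D2_def vec_eq_iff forall_3 mat_def off)
qed

lemma D2_square:
  assumes "g \<in> D2"
  shows "g$i$i * g$i$i = 1"
  using assms exhaust_3[of i] by (auto simp: D2_def mat_def)

lemma D2_subset_symgrp2_set_iff: "D2 \<subseteq> symgrp2_set S \<longleftrightarrow> (\<forall>a\<in>S. diagonal a)"
proof (intro iffI ballI subsetI)
  fix a assume D2: "D2 \<subseteq> symgrp2_set S" and a: "a \<in> S"
  show "diagonal a"
    unfolding diagonal_def
  proof (intro allI impI)
    fix i j :: 3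
    assume "i \<noteq> j"
    have "diagonal (half_turn i)" "half_turn i ** a = a ** half_turn i"
      using D2 a half_turn_in_D2[of i] by (auto simp: D2_iff_diagonal symgrp2_set_def act2_eq_self_iff)
    then have "half_turn i $ i $ i * a$i$j = a$i$j * half_turn i $ j $ j"
      by (metis diagonal_mult_left diagonal_mult_right)
    then show "a$i$j = 0"
      using \<open>i \<noteq> j\<close> by (simp add: half_turn_def)
  qed
next
  fix g assume "\<forall>a\<in>S. diagonal a" "g \<in> D2"
  then show "g \<in> symgrp2_set S"
    by (auto simp: D2_iff_diagonal symgrp2_set_def act2_eq_self_iff intro: diagonal_commute)
qed

lemma orthotropic_symgrp2_set_commute:
  assumes "orthotropic (symgrp2_set S)" "a \<in> S" "b \<in> S"
  shows "a ** b = b ** a"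
proof -
  obtain g where g: "g \<in> SO3" "act2 g ` symgrp2_set S = D2"
    using assms(1) by (rule orthotropic_frame)
  then have "\<forall>x \<in> act2 g ` S. diagonal x"
    by (simp add: symgrp2_set_act2 flip: D2_subset_symgrp2_set_iff)
  then have "act2 g a ** act2 g b = act2 g b ** act2 g a"
    using assms(2,3) by (intro diagonal_commute) auto
  then show ?thesis
    by (simp add: act2_commute_iff g(1))
qed

text \<open>The rotation by \<open>\<pi>\<close> about \<open>e\<^sub>i - e\<^sub>j\<close>.\<close>

definition swap_rot :: "3 \<Rightarrow> 3 \<Rightarrow> ten2" where
  "swap_rot i j = (\<chi> p q. if q = Transposition.transpose i j p then -1 else 0)"

lemma contr_swap_rot: "contr (swap_rot i j) p X = - X (Transposition.transpose i j p)"
proof -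
  have "contr (swap_rot i j) p X
      = (\<Sum>q\<in>UNIV. if q = Transposition.transpose i j p then - X (Transposition.transpose i j p) else 0)"
    unfolding contr_def swap_rot_def by (rule sum.cong) auto
  then show ?thesis by simp
qed

lemma swap_rot_SO3:
  assumes "i \<noteq> j"
  shows "swap_rot i j \<in> SO3"
proof -
  have "transpose (swap_rot i j) = swap_rot i j"
    by (auto simp: vec_eq_iff transpose_def swap_rot_def)
  moreover have "swap_rot i j ** swap_rot i j = mat 1"
  proof -
    have "(swap_rot i j ** swap_rot i j) $ p $ q = contr (swap_rot i j) p (\<lambda>k. swap_rot i j $ k $ q)" for p q
      by (simp add: matrix_matrix_mult_def contr_def)
    then show ?thesis
      by (simp add: vec_eq_iff mat_def contr_swap_rot) (auto simp: swap_rot_def)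
  qed
  moreover have "det (swap_rot i j) = 1"
    using assms exhaust_3[of i] exhaust_3[of j] by (auto simp: det_3 swap_rot_def Transposition.transpose_def)
  ultimately show ?thesis by (simp add: SO3_def orthogonal_matrix)
qed

lemma swap_rot_notin_D2:
  assumes "i \<noteq> j"
  shows "swap_rot i j \<notin> D2"
proof -
  have "swap_rot i j $ i $ j \<noteq> 0" by (simp add: swap_rot_def)
  then show ?thesis using assms unfolding D2_iff_diagonal diagonal_def by blast
qed

definition separates_axes :: "ten2 set \<Rightarrow> bool" where
  "separates_axes S \<longleftrightarrow> (\<forall>i j. i \<noteq> j \<longrightarrow> (\<exists>a\<in>S. a$i$i \<noteq> a$j$j))"

lemma symgrp2_set_subset_D2:
  assumes diag: "\<forall>a\<in>S. diagonal a" and sep: "separates_axes S"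
  shows "symgrp2_set S \<subseteq> D2"
proof
  fix g assume g: "g \<in> symgrp2_set S"
  then have "g \<in> SO3" by (simp add: symgrp2_set_def)
  have "g$i$j = 0" if "i \<noteq> j" for i j
  proof -
    obtain a where a: "a \<in> S" "a$i$i \<noteq> a$j$j"
      using sep \<open>i \<noteq> j\<close> by (auto simp: separates_axes_def)
    have "g ** a = a ** g"
      using g a(1) \<open>g \<in> SO3\<close> by (simp add: symgrp2_set_def act2_eq_self_iff)
    then have "(g ** a) $ i $ j = (a ** g) $ i $ j" by simp
    then have "g$i$j * a$j$j = a$i$i * g$i$j"
      using diag a(1) by (simp add: diagonal_mult_left diagonal_mult_right)
    then show ?thesis using a(2) by simp
  qed
  then show "g \<in> D2"
    using \<open>g \<in> SO3\<close> by (simp add: D2_iff_diagonal diagonal_def)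
qed

lemma swap_rot_commute_diagonal:
  assumes "diagonal a" "a$i$i = a$j$j"
  shows "swap_rot i j ** a = a ** swap_rot i j"
proof -
  have "swap_rot i j $ p $ q * a$q$q = a$p$p * swap_rot i j $ p $ q" for p q
  proof (cases "q = Transposition.transpose i j p")
    case True
    then have "a$p$p = a$q$q"
      using assms(2) by (simp add: Transposition.transpose_def)
    then show ?thesis by simp
  qed (simp add: swap_rot_def)
  then show ?thesis
    using assms(1) by (simp add: vec_eq_iff diagonal_mult_left diagonal_mult_right)
qed

lemma symgrp2_set_eq_D2_iff:
  "symgrp2_set S = D2 \<longleftrightarrow> (\<forall>a\<in>S. diagonal a) \<and> separates_axes S"
proof
  assume "(\<forall>a\<in>S. diagonal a) \<and> separates_axes S"
  then show "symgrp2_set S = D2"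
    using symgrp2_set_subset_D2 D2_subset_symgrp2_set_iff by blast
next
  assume S: "symgrp2_set S = D2"
  then have diag: "\<forall>a\<in>S. diagonal a"
    using D2_subset_symgrp2_set_iff by blast
  have "\<exists>a\<in>S. a$i$i \<noteq> a$j$j" if ij: "i \<noteq> j" for i j
  proof (rule ccontr)
    assume "\<not> ?thesis"
    then have "swap_rot i j \<in> symgrp2_set S"
      using swap_rot_SO3[OF ij] diag
      by (auto simp: symgrp2_set_def act2_eq_self_iff intro: swap_rot_commute_diagonal)
    then show False
      using S swap_rot_notin_D2[OF ij] by blast
  qed
  with diag show "(\<forall>a\<in>S. diagonal a) \<and> separates_axes S"
    by (simp add: separates_axes_def)
qed

definition diag_vec :: "real^'n^'n \<Rightarrow> real^'n" where
  "diag_vec a = (\<chi> k. a$k$k)"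

definition diag_slice :: "ten4 \<Rightarrow> 3 \<Rightarrow> 3 \<Rightarrow> vec3" where
  "diag_slice H i j = (\<chi> k. H i j k k)"

lemma diag_vec_nth: "diag_vec a $ k = a$k$k"
  by (simp add: diag_vec_def)

lemma diag_slice_nth: "diag_slice H i j $ k = H i j k k"
  by (simp add: diag_slice_def)

lemma dd2_diagonal:
  assumes "diagonal a"
  shows "dd2 H a $ i $ j = diag_slice H i j \<bullet> diag_vec a"
proof -
  have "(\<Sum>l\<in>UNIV. H i j k l * a$k$l) = (\<Sum>l\<in>UNIV. if l = k then H i j k k * a$k$k else 0)" for k
    by (rule sum.cong) (use assms in \<open>auto simp: diagonal_def\<close>)
  then show ?thesis by (simp add: dd2_def inner_vec_def diag_vec_nth diag_slice_nth)
qed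

lemma diag_slice_commute: "H \<in> harm4 \<Longrightarrow> diag_slice H j i = diag_slice H i j"
  using harm4_sym(1) by (simp add: diag_slice_def)

lemma diag_slice_inner_1:
  assumes "H \<in> harm4"
  shows "diag_slice H i j \<bullet> 1 = 0"
proof -
  have "H i j k k = H k k i j" for k
    by (metis harm4_sym[OF assms])
  then show ?thesis
    using harm4_trace[OF assms, of i j] by (simp add: inner_vec_def diag_slice_nth)
qed

lemma act4_D2:
  assumes "g \<in> D2"
  shows "act4 g T i j k l = g$i$i * g$j$j * g$k$k * g$l$l * T i j k l"
  using assms by (simp add: act4_contr contr_diagonal D2_iff_diagonal)

lemma harm4_eqI:
  assumes "T \<in> harm4" "T' \<in> harm4" and eq: "\<And>i j k. T i j k k = T' i j k k"
  shows "T = T'"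
proof (intro ext)
  fix i j k l :: 3
  note T_sym = harm4_sym[OF assms(1)] and T'_sym = harm4_sym[OF assms(2)]
  have "i = j \<or> i = k \<or> i = l \<or> j = k \<or> j = l \<or> k = l"
    using exhaust_3[of i] exhaust_3[of j] exhaust_3[of k] exhaust_3[of l] by auto
  moreover have "T i j k k = T' i j k k" "T k k i j = T' k k i j" "T k i k j = T' k i k j"
    "T k i j k = T' k i j k" "T i k k j = T' i k k j" "T i k j k = T' i k j k" for i j k
    using eq[of i j k] by (simp_all add: T_sym T'_sym)
  ultimately show "T i j k l = T' i j k l" by blast
qed

lemma D2_subset_symgrp4_iff:
  assumes "H \<in> harm4"
  shows "D2 \<subseteq> symgrp4 H \<longleftrightarrow> (\<forall>i j. i \<noteq> j \<longrightarrow> diag_slice H i j = 0)"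
proof (intro iffI allI impI subsetI)
  fix i j :: 3
  assume D: "D2 \<subseteq> symgrp4 H" and "i \<noteq> j"
  have "H i j k k = 0" for k
  proof -
    have "act4 (half_turn i) H i j k k = H i j k k"
      using D half_turn_in_D2[of i] by (auto simp: symgrp4_def)
    then show ?thesis
      using \<open>i \<noteq> j\<close> unfolding act4_D2[OF half_turn_in_D2]
      by (simp add: half_turn_def split: if_splits)
  qed
  then show "diag_slice H i j = 0"
    by (simp add: vec_eq_iff diag_slice_nth)
next
  fix g assume slices: "\<forall>i j. i \<noteq> j \<longrightarrow> diag_slice H i j = 0" and g: "g \<in> D2"
  then have "g \<in> SO3" by (simp add: D2_iff_diagonal)
  have "act4 g H i j k k = H i j k k" for i j k
  proof (cases "i = j")
    case True
    have "g$i$i * g$i$i * (g$k$k * g$k$k) * H i i k k = H i i k k"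
      by (simp only: D2_square[OF g] mult_1)
    then show ?thesis using True by (simp add: act4_D2[OF g] mult.assoc)
  next
    case False
    then have "H i j k k = 0" using slices by (simp add: vec_eq_iff diag_slice_nth)
    then show ?thesis by (simp add: act4_D2[OF g])
  qed
  then show "g \<in> symgrp4 H"
    using harm4_eqI[OF act4_harm4[OF SO3_orthogonal assms] assms] \<open>g \<in> SO3\<close> by (simp add: symgrp4_def)
qed

lemma symgrp4_eq_D2I:
  assumes H: "H \<in> harm4" and "S \<subseteq> Cov2 H" "symgrp2_set S = D2"
    and "\<And>i j. i \<noteq> j \<Longrightarrow> diag_slice H i j = 0"
  shows "symgrp4 H = D2"
proof
  show "symgrp4 H \<subseteq> D2"
    using symgrp4_subset_symgrp2_set[OF assms(1,2)] assms(3) by simp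
  show "D2 \<subseteq> symgrp4 H"
    using assms(4) by (simp add: D2_subset_symgrp4_iff[OF H])
qed

section \<open>The quadratic and cubic covariants in components\<close>

lemma harm4_iiii:
  assumes "H \<in> harm4" "distinct [i, j, k]"
  shows "H i i i i = - (H i i j j + H i i k k)"
  using diag_slice_inner_1[OF assms(1), of i i]
  by (simp add: inner_vec_def diag_slice_nth sum_distinct_3[OF assms(2)])

lemma d2_diagonal_component:
  assumes "H \<in> harm4" "distinct [i, j, k]"
  shows "d2 H $ i $ i =
    (H i i j j + H i i k k)\<^sup>2 + 3 * (H i i j j)\<^sup>2 + 3 * (H i i k k)\<^sup>2
    + 3 * (H i j i i)\<^sup>2 + (H i j j j)\<^sup>2 + 3 * (H i j k k)\<^sup>2
    + 3 * (H i k i i)\<^sup>2 + 3 * (H i k j j)\<^sup>2 + (H i k k k)\<^sup>2 + 6 * (H j k i i)\<^sup>2"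
  by (simp add: d2_harm4[OF assms(1)] sum_distinct_3[OF assms(2)] harm4_sym[OF assms(1)]
      harm4_iiii[OF assms] algebra_simps power2_eq_square)

lemma d2_offdiagonal_component:
  assumes "H \<in> harm4" "distinct [i, j, k]"
  shows "d2 H $ i $ j =
    2 * H i i j j * (H i j i i + H i j j j) - H i i k k * H i j i i - H j j k k * H i j j j
    + 3 * (H i i k k + H j j k k) * H i j k k
    + 3 * H i k i i * H j k i i + 3 * H i k j j * H j k j j + H i k k k * H j k k k
    + 6 * H j k i i * H i k j j"
proof -
  have jjjj: "H j j j j = - (H i i j j + H j j k k)"
    using harm4_iiii[OF assms(1), of j i k] assms(2) by (auto simp: harm4_sym[OF assms(1)])
  show ?thesis
    by (simp add: d2_harm4[OF assms(1)] sum_distinct_3[OF assms(2)] harm4_sym[OF assms(1)]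
        harm4_iiii[OF assms] jjjj algebra_simps)
qed

lemma dd2_diagonal_component:
  assumes "H \<in> harm4" "distinct [i, j, k]" "diagonal a"
  shows "dd2 H a $ i $ i = H i i j j * (a$j$j - a$i$i) + H i i k k * (a$k$k - a$i$i)"
  by (simp add: dd2_diagonal[OF assms(3)] inner_vec_def sum_distinct_3[OF assms(2)] diag_slice_nth
      diag_vec_nth harm4_iiii[OF assms(1,2)] algebra_simps)

section \<open>Orthotropic tensors\<close>

lemma swap_rot_in_symgrp4:
  assumes H: "H \<in> harm4" and slices: "\<And>i j. i \<noteq> j \<Longrightarrow> diag_slice H i j = 0"
    and ijk: "distinct [i, j, k]" and eq: "H i i k k = H j j k k"
  shows "swap_rot i j \<in> symgrp4 H"
proof -
  let ?s = "Transposition.transpose i j"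
  have iiii: "H i i i i = - (H i i j j + H i i k k)" "H j j j j = - (H i i j j + H j j k k)"
    "H k k k k = - (H i i k k + H j j k k)"
    using harm4_iiii[OF H, of i j k] harm4_iiii[OF H, of j i k] harm4_iiii[OF H, of k i j] ijk
    by (auto simp: harm4_sym[OF H])
  have "H (?s p) (?s q) (?s l) (?s l) = H p q l l" for p q l
  proof (cases "p = q")
    case True
    have "\<forall>p l. H (?s p) (?s p) (?s l) (?s l) = H p p l l"
      using ijk eq by (auto simp: all_distinct_3[OF ijk] iiii harm4_sym[OF H])
    then show ?thesis using True by simp
  next
    case False
    then have "?s p \<noteq> ?s q" by (metis transpose_eq_imp_eq)
    then show ?thesis
      using slices False by (simp flip: diag_slice_nth)
  qed
  then have "act4 (swap_rot i j) H p q l l = H p q l l" for p q l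
    by (simp add: act4_contr contr_swap_rot)
  moreover have "swap_rot i j \<in> SO3"
    using ijk by (simp add: swap_rot_SO3)
  ultimately show ?thesis
    using harm4_eqI[OF act4_harm4[OF SO3_orthogonal H] H] by (simp add: symgrp4_def)
qed

lemma axis_invariants_separate:
  fixes a b c :: real
  defines "f1 \<equiv> (b + c)\<^sup>2 + 3 * b\<^sup>2 + 3 * c\<^sup>2" and "f2 \<equiv> (a + c)\<^sup>2 + 3 * a\<^sup>2 + 3 * c\<^sup>2"
    and "f3 \<equiv> (a + b)\<^sup>2 + 3 * a\<^sup>2 + 3 * b\<^sup>2"
  assumes ne: "a \<noteq> b" "b \<noteq> c" "a \<noteq> c" and eq: "f1 = f2"
  shows "c * (f2 - f1) + b * (f3 - f1) \<noteq> c * (f1 - f2) + a * (f3 - f2)"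
proof
  assume "c * (f2 - f1) + b * (f3 - f1) = c * (f1 - f2) + a * (f3 - f2)"
  then have "(b - a) * (f3 - f1) = 0"
    unfolding eq by (simp add: algebra_simps)
  then have "f3 = f1" using ne by simp
  then have "(c - a) * (2 * c + 2 * a + b) = 0"
    unfolding f1_def f3_def by (simp add: algebra_simps power2_eq_square)
  moreover have "(b - a) * (2 * a + 2 * b + c) = 0"
    using eq unfolding f1_def f2_def by (simp add: algebra_simps power2_eq_square)
  ultimately show False using ne by auto
qed

lemma separates_axes_d2_c3:
  assumes H: "H \<in> harm4"
    and slices: "\<And>i j. i \<noteq> j \<Longrightarrow> diag_slice H i j = 0"
    and axis_values_distinct: "\<And>i j k. distinct [i, j, k] \<Longrightarrow> H i i k k \<noteq> H j j k k"
    and d2_diag: "diagonal (d2 H)"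
  shows "separates_axes {d2 H, c3 H}"
  unfolding separates_axes_def
proof (intro allI impI)
  fix i j :: 3
  assume "i \<noteq> j"
  then obtain k where ijk: "distinct [i, j, k]" by (rule obtain_third_index)
  have perm: "distinct [j, i, k]" "distinct [k, i, j]" using ijk by auto
  define a b c where "a = H j j k k" and "b = H i i k k" and "c = H i i j j"
  have axis_sym: "H j j i i = c" "H k k i i = b" "H k k j j = a"
    by (simp_all add: a_def b_def c_def harm4_sym[OF H])
  have ne: "a \<noteq> b" "b \<noteq> c" "a \<noteq> c"
    using axis_values_distinct[of j i k] axis_values_distinct[of k j i] axis_values_distinct[of k i j] ijk axis_sym
    by (auto simp: a_def b_def c_def)
  have mixed_zero: "H p q l l = 0" if "p \<noteq> q" for p q l
    using slices[OF that] by (simp add: vec_eq_iff diag_slice_nth)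
  have D: "d2 H $ i $ i = (b + c)\<^sup>2 + 3 * b\<^sup>2 + 3 * c\<^sup>2" "d2 H $ j $ j = (a + c)\<^sup>2 + 3 * a\<^sup>2 + 3 * c\<^sup>2"
    "d2 H $ k $ k = (a + b)\<^sup>2 + 3 * a\<^sup>2 + 3 * b\<^sup>2"
    using ijk by (auto simp: d2_diagonal_component[OF H ijk] d2_diagonal_component[OF H perm(1)]
        d2_diagonal_component[OF H perm(2)] mixed_zero axis_sym add_ac simp flip: a_def b_def c_def)
  have C: "c3 H $ i $ i = c * (d2 H $ j $ j - d2 H $ i $ i) + b * (d2 H $ k $ k - d2 H $ i $ i)"
    "c3 H $ j $ j = c * (d2 H $ i $ i - d2 H $ j $ j) + a * (d2 H $ k $ k - d2 H $ j $ j)"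
    unfolding c3_def dd2_diagonal_component[OF H ijk d2_diag] dd2_diagonal_component[OF H perm(1) d2_diag]
    by (simp_all add: axis_sym flip: a_def b_def c_def)
  have "c3 H $ i $ i \<noteq> c3 H $ j $ j" if "d2 H $ i $ i = d2 H $ j $ j"
    using axis_invariants_separate[OF ne] that unfolding C D by blast
  then show "\<exists>m\<in>{d2 H, c3 H}. m $ i $ i \<noteq> m $ j $ j" by auto
qed

lemma symgrp2_set_d2_c3_eq_D2:
  assumes H: "H \<in> harm4" and sym: "symgrp4 H = D2"
  shows "symgrp2_set {d2 H, c3 H} = D2"
proof -
  have "D2 \<subseteq> symgrp2_set {d2 H, c3 H}"
    using symgrp4_subset_symgrp2_set[OF H, of "{d2 H, c3 H}"] by (simp add: sym d2_in_Cov2 c3_in_Cov2)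
  then have diag: "\<forall>a\<in>{d2 H, c3 H}. diagonal a"
    unfolding D2_subset_symgrp2_set_iff .
  have slices: "diag_slice H i j = 0" if "i \<noteq> j" for i j
    using D2_subset_symgrp4_iff[OF H] sym that by blast
  have "H i i k k \<noteq> H j j k k" if "distinct [i, j, k]" for i j k
    using swap_rot_in_symgrp4[OF H slices that] swap_rot_notin_D2[of i j] sym that by auto
  then have "separates_axes {d2 H, c3 H}"
    using diag slices by (intro separates_axes_d2_c3 H) auto
  with diag show ?thesis
    unfolding symgrp2_set_eq_D2_iff by blast
qed

section \<open>Orthotropic covariants\<close>

lemma Cov2_isolates_axis:
  assumes cov: "symgrp2_set (Cov2 H) = D2" and "distinct [k, m, n]"
  obtains e where "e \<in> Cov2 H" "e$k$k \<noteq> 0" "e$m$m = 0" "e$n$n = 0"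
proof -
  have diag: "diagonal a" if "a \<in> Cov2 H" for a
    using cov that unfolding symgrp2_set_eq_D2_iff by blast
  have vanishing_at: "\<exists>f\<in>Cov2 H. f$k$k \<noteq> 0 \<and> f$l$l = 0" if "k \<noteq> l" for l
  proof -
    obtain f where f: "f \<in> Cov2 H" "f$k$k \<noteq> f$l$l"
      using cov \<open>k \<noteq> l\<close> unfolding symgrp2_set_eq_D2_iff separates_axes_def by blast
    let ?f = "f + (- f$l$l) *\<^sub>R mat 1"
    have "?f \<in> Cov2 H"
      by (intro Cov2_add Cov2_scaleR Cov2_mat_1 f(1))
    moreover have "?f$k$k \<noteq> 0" "?f$l$l = 0"
      using f(2) by (simp_all add: mat_def)
    ultimately show ?thesis by blast
  qed
  obtain f where f: "f \<in> Cov2 H" "f$k$k \<noteq> 0" "f$m$m = 0"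
    using vanishing_at[of m] assms(2) by auto
  obtain h where h: "h \<in> Cov2 H" "h$k$k \<noteq> 0" "h$n$n = 0"
    using vanishing_at[of n] assms(2) by auto
  have "(f ** h + h ** f) $ l $ l = 2 * f$l$l * h$l$l" for l
    by (simp add: diagonal_mult_left diag f(1) h(1))
  then show ?thesis
    using that[OF Cov2_jordan[OF f(1) h(1)]] f h by simp
qed

lemma symgrp4_eq_D2_of_Cov2:
  assumes H: "H \<in> harm4" and cov: "symgrp2_set (Cov2 H) = D2"
  shows "symgrp4 H = D2"
proof -
  have diag: "diagonal a" if "a \<in> Cov2 H" for a
    using cov that unfolding symgrp2_set_eq_D2_iff by blast
  have "diag_slice H i j $ k = 0" if "i \<noteq> j" for i j k
  proof -
    obtain m :: 3 where "k \<noteq> m" using exhaust_3[of k] by (metis zero_neq_one)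
    then obtain n where kmn: "distinct [k, m, n]" by (rule obtain_third_index)
    obtain e where e: "e \<in> Cov2 H" "e$k$k \<noteq> 0" "e$m$m = 0" "e$n$n = 0"
      using Cov2_isolates_axis[OF cov kmn] .
    have "dd2 H e $ i $ j = diag_slice H i j $ k * e$k$k"
      using e by (simp add: dd2_diagonal diag inner_vec_def sum_distinct_3[OF kmn] diag_vec_nth)
    moreover have "dd2 H e $ i $ j = 0"
      using diag[OF Cov2_dd2[OF e(1)]] that by (simp add: diagonal_def)
    ultimately show ?thesis using e(2) by simp
  qed
  then show ?thesis
    by (intro symgrp4_eq_D2I[OF H subset_refl cov]) (simp add: vec_eq_iff)
qed

section \<open>Cross products\<close>

unbundle cross3_syntax

lemma orthogonal_imp_cross3_multiple:
  fixes p q v :: "real^3"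
  assumes "p \<times> q \<noteq> 0" "v \<bullet> p = 0" "v \<bullet> q = 0"
  obtains s where "v = s *\<^sub>R (p \<times> q)"
proof -
  let ?n = "p \<times> q"
  have "v \<times> ?n = 0" by (simp add: Lagrange assms(2,3))
  then have "(?n \<bullet> ?n) *\<^sub>R v = (?n \<bullet> v) *\<^sub>R ?n"
    using Lagrange[of ?n v ?n] by simp
  then have "v = ((?n \<bullet> v) / (?n \<bullet> ?n)) *\<^sub>R ?n"
    using assms(1) by (simp add: eq_vector_fraction_iff)
  then show ?thesis by (rule that)
qed

lemma orthogonal_cross3_imp_combination:
  fixes p q v :: "real^3"
  assumes "p \<times> q \<noteq> 0" "v \<bullet> (p \<times> q) = 0"
  obtains s t where "v = s *\<^sub>R p + t *\<^sub>R q"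
proof -
  let ?n = "p \<times> q"
  have n_cross: "?n \<times> p = (p \<bullet> p) *\<^sub>R q - (p \<bullet> q) *\<^sub>R p" "?n \<times> q = (p \<bullet> q) *\<^sub>R q - (q \<bullet> q) *\<^sub>R p"
    by (simp_all add: cross_skew[of ?n] Lagrange inner_commute)
  have "(?n \<bullet> ?n) *\<^sub>R v = ?n \<times> (v \<times> ?n)"
    using assms(2) by (simp add: Lagrange[of ?n v] inner_commute)
  also have "\<dots> = (v \<bullet> q) *\<^sub>R (?n \<times> p) - (v \<bullet> p) *\<^sub>R (?n \<times> q)"
    by (simp add: Lagrange[of v] Cross3.right_diff_distrib cross_mult_right)
  also have "\<dots> = ((v \<bullet> p) * (q \<bullet> q) - (v \<bullet> q) * (p \<bullet> q)) *\<^sub>R p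
      + ((v \<bullet> q) * (p \<bullet> p) - (v \<bullet> p) * (p \<bullet> q)) *\<^sub>R q" (is "_ = ?s *\<^sub>R p + ?t *\<^sub>R q")
    unfolding n_cross by (simp add: algebra_simps)
  finally have "v = (1 / (?n \<bullet> ?n)) *\<^sub>R (?s *\<^sub>R p + ?t *\<^sub>R q)"
    using assms(1) by (simp add: eq_vector_fraction_iff)
  then show ?thesis
    using that[of "?s / (?n \<bullet> ?n)" "?t / (?n \<bullet> ?n)"] by (simp add: scaleR_add_right)
qed

lemma levi_civita_eq_1_iff:
  "levi_civita i j k = 1 \<longleftrightarrow> (i, j, k) = (1, 2, 3) \<or> (i, j, k) = (2, 3, 1) \<or> (i, j, k) = (3, 1, 2)"
  by (simp add: levi_civita_def)

lemma levi_civita_rotate: "levi_civita i j k = 1 \<Longrightarrow> levi_civita j k i = 1"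
  by (auto simp: levi_civita_eq_1_iff)

lemma levi_civita_distinct: "levi_civita i j k = 1 \<Longrightarrow> distinct [i, j, k]"
  by (auto simp: levi_civita_eq_1_iff)

lemma cross3_one_component: "levi_civita i j k = 1 \<Longrightarrow> (x \<times> 1) $ k = x$i - x$j"
  by (auto simp: levi_civita_eq_1_iff cross_components)

section \<open>Collinear diagonal slices\<close>

text \<open>
  The case in which \<open>d2 H\<close> is diagonal with distinct entries and \<open>c3 H\<close> is a linear combination of
  \<open>d2 H\<close> and the identity. Here \<open>x\<close> is the deviatoric part and \<open>\<mu>\<close> the mean of the diagonal of \<open>d2 H\<close>.
\<close>

locale collinear_slices =
  fixes H :: ten4 and x t :: vec3 and \<kappa> \<rho> \<mu> :: real
  assumes H: "H \<in> harm4"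
    and d2_diagonal: "diagonal (d2 H)"
    and d2_diagonal_entry: "d2 H $ i $ i = x$i + \<mu>"
    and x_sum: "x \<bullet> 1 = 0"
    and x_distinct: "i \<noteq> j \<Longrightarrow> x$i \<noteq> x$j"
    and axis_value: "levi_civita i j k = 1 \<Longrightarrow> H i i j j = \<kappa> * (x$k)\<^sup>2 + \<rho>"
    and slice: "levi_civita i j k = 1 \<Longrightarrow> diag_slice H i j = t$k *\<^sub>R (x \<times> 1)"
begin

definition coupling :: "3 \<Rightarrow> real" where
  "coupling i = 4 * \<kappa> * (x$i)\<^sup>2 - (7/2 * \<kappa> * (x \<bullet> x) + 5 * \<rho>)"

definition self_gap :: "3 \<Rightarrow> real" where
  "self_gap i = 2 * \<kappa> * x$i * (2 * \<kappa> * (x \<bullet> x) + 5 * \<rho> - \<kappa> * (x$i)\<^sup>2)"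

lemma H_components:
  assumes "levi_civita i j k = 1"
  shows "H i i j j = \<kappa> * (x$k)\<^sup>2 + \<rho>" "H i i k k = \<kappa> * (x$j)\<^sup>2 + \<rho>" "H j j k k = \<kappa> * (x$i)\<^sup>2 + \<rho>"
    "H i j i i = t$k * (x$j - x$k)" "H i j j j = t$k * (x$k - x$i)" "H i j k k = t$k * (x$i - x$j)"
    "H i k i i = t$j * (x$j - x$k)" "H i k j j = t$j * (x$k - x$i)" "H i k k k = t$j * (x$i - x$j)"
    "H j k i i = t$i * (x$j - x$k)" "H j k j j = t$i * (x$k - x$i)" "H j k k k = t$i * (x$i - x$j)"
proof -
  note rot = levi_civita_rotate[OF assms] levi_civita_rotate[OF levi_civita_rotate[OF assms]]
  show "H i i j j = \<kappa> * (x$k)\<^sup>2 + \<rho>" "H j j k k = \<kappa> * (x$i)\<^sup>2 + \<rho>" "H i i k k = \<kappa> * (x$j)\<^sup>2 + \<rho>"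
    using axis_value[OF assms] axis_value[OF rot(1)] axis_value[OF rot(2)]
    by (simp_all add: harm4_sym[OF H])
  note normal = cross3_one_component[OF assms] cross3_one_component[OF rot(1)] cross3_one_component[OF rot(2)]
  show "H i j i i = t$k * (x$j - x$k)" "H i j j j = t$k * (x$k - x$i)" "H i j k k = t$k * (x$i - x$j)"
    using slice[OF assms] by (simp_all add: normal flip: diag_slice_nth)
  show "H j k i i = t$i * (x$j - x$k)" "H j k j j = t$i * (x$k - x$i)" "H j k k k = t$i * (x$i - x$j)"
    using slice[OF rot(1)] by (simp_all add: normal flip: diag_slice_nth)
  show "H i k i i = t$j * (x$j - x$k)" "H i k j j = t$j * (x$k - x$i)" "H i k k k = t$j * (x$i - x$j)"
    using slice[OF rot(2)] by (simp_all add: normal diag_slice_commute[OF H, of k] flip: diag_slice_nth)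
qed

lemma x_expansion:
  assumes "levi_civita i j k = 1"
  shows "x$k = - x$i - x$j" "x \<bullet> x = (x$i)\<^sup>2 + (x$j)\<^sup>2 + (x$k)\<^sup>2"
  using x_sum by (simp_all add: inner_vec_def sum_distinct_3[OF levi_civita_distinct[OF assms]] power2_eq_square)

lemma coupling_equation:
  assumes "levi_civita i j k = 1"
  shows "4 * t$i * t$j * (x$i - x$j) = coupling k * t$k"
proof -
  note ijk = levi_civita_distinct[OF assms]
  have "d2 H $ i $ j = (x$i - x$j) * (4 * t$i * t$j * (x$i - x$j) - coupling k * t$k)"
    unfolding d2_offdiagonal_component[OF H ijk] H_components[OF assms] coupling_def x_expansion[OF assms]
    by (simp add: field_simps power2_eq_square)
  then show ?thesis
    using d2_diagonal x_distinct[of i j] ijk by (simp add: diagonal_def)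
qed

lemma gap_equation:
  assumes "levi_civita i j k = 1"
  shows "self_gap k + 6 * x$k * (t$k)\<^sup>2 + (2 * x$j + 10 * x$k) * (t$i)\<^sup>2 + (2 * x$i + 10 * x$k) * (t$j)\<^sup>2 = 1"
    (is "?gap = 1")
proof -
  note ijk = levi_civita_distinct[OF assms] and rot = levi_civita_rotate[OF assms]
  have "x$i - x$j = d2 H $ i $ i - d2 H $ j $ j"
    by (simp add: d2_diagonal_entry)
  also have "\<dots> = (x$i - x$j) * ?gap"
    unfolding d2_diagonal_component[OF H ijk] H_components[OF assms]
      d2_diagonal_component[OF H levi_civita_distinct[OF rot]] H_components[OF rot]
      self_gap_def x_expansion[OF assms]
    by (simp add: algebra_simps power2_eq_square)
  finally show ?thesis
    using x_distinct[of i j] ijk by simp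
qed

lemma coupling_product:
  assumes "levi_civita i j k = 1" "t$i \<noteq> 0" "t$j \<noteq> 0"
  shows "16 * (t$k)\<^sup>2 * ((x$j - x$k) * (x$k - x$i)) = coupling i * coupling j"
proof -
  note rot = levi_civita_rotate[OF assms(1)] levi_civita_rotate[OF levi_civita_rotate[OF assms(1)]]
  have "(16 * (t$k)\<^sup>2 * ((x$j - x$k) * (x$k - x$i))) * (t$i * t$j) = (coupling i * coupling j) * (t$i * t$j)"
    using arg_cong2[OF coupling_equation[OF rot(1)] coupling_equation[OF rot(2)], of "(*)"]
    by (simp add: algebra_simps power2_eq_square)
  then show ?thesis using assms(2,3) by simp
qed

lemma some_coefficient_vanishes:
  assumes ijk: "levi_civita i j k = 1"
  shows "t$i = 0 \<or> t$j = 0 \<or> t$k = 0"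
proof (rule ccontr)
  assume "\<not> ?thesis"
  then have nonzero: "t$i \<noteq> 0" "t$j \<noteq> 0" "t$k \<noteq> 0" by auto
  note rot = levi_civita_rotate[OF ijk] levi_civita_rotate[OF levi_civita_rotate[OF ijk]]
  note product = coupling_product[OF ijk nonzero(1,2)] coupling_product[OF rot(1) nonzero(2,3)]
    coupling_product[OF rot(2) nonzero(3,1)]
  define W where "W = (x$i - x$j) * (x$j - x$k) * (x$k - x$i)"
  have "16 * W = 16 * W * (self_gap k + 6 * x$k * (t$k)\<^sup>2
      + (2 * x$j + 10 * x$k) * (t$i)\<^sup>2 + (2 * x$i + 10 * x$k) * (t$j)\<^sup>2)"
    by (simp add: gap_equation[OF ijk])
  also have "\<dots> = 16 * W * self_gap k
      + 6 * x$k * (x$i - x$j) * (16 * (t$k)\<^sup>2 * ((x$j - x$k) * (x$k - x$i)))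
      + (2 * x$j + 10 * x$k) * (x$j - x$k) * (16 * (t$i)\<^sup>2 * ((x$k - x$i) * (x$i - x$j)))
      + (2 * x$i + 10 * x$k) * (x$k - x$i) * (16 * (t$j)\<^sup>2 * ((x$i - x$j) * (x$j - x$k)))"
    unfolding W_def by (simp only: algebra_simps)
  also have "\<dots> = 16 * W * self_gap k + 6 * x$k * (x$i - x$j) * (coupling i * coupling j)
      + (2 * x$j + 10 * x$k) * (x$j - x$k) * (coupling j * coupling k)
      + (2 * x$i + 10 * x$k) * (x$k - x$i) * (coupling k * coupling i)"
    unfolding product ..
  also have "\<dots> = 0"
    unfolding W_def coupling_def self_gap_def x_expansion[OF ijk]
    by (simp add: field_simps power2_eq_square)
  finally show False
    using x_distinct[of i j] x_distinct[of j k] x_distinct[of k i] levi_civita_distinct[OF ijk]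
    by (auto simp: W_def)
qed

lemma last_coefficient_vanishes:
  assumes ijk: "levi_civita i j k = 1" and zero: "t$i = 0" "t$j = 0"
  shows "t$k = 0"
proof (rule ccontr)
  assume "t$k \<noteq> 0"
  then have "coupling k = 0"
    using coupling_equation[OF ijk] zero by simp
  then have \<rho>: "5 * \<rho> = 4 * \<kappa> * (x$k)\<^sup>2 - 7/2 * \<kappa> * (x \<bullet> x)"
    by (simp add: coupling_def)
  let ?s = "2 * \<kappa>\<^sup>2 * x$i * x$j + 2 * (t$k)\<^sup>2"
  note rot = levi_civita_rotate[OF ijk] levi_civita_rotate[OF levi_civita_rotate[OF ijk]]
  have gap_jk: "(5 * x$i + x$j) * ?s = 1"
    using gap_equation[OF rot(1)] zero
    unfolding self_gap_def \<rho> x_expansion[OF ijk] by (simp add: field_simps power2_eq_square)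
  have gap_ki: "(x$i + 5 * x$j) * ?s = 1"
    using gap_equation[OF rot(2)] zero
    unfolding self_gap_def \<rho> x_expansion[OF ijk] by (simp add: field_simps power2_eq_square)
  have "4 * ((x$i - x$j) * ?s) = (5 * x$i + x$j) * ?s - (x$i + 5 * x$j) * ?s"
    by (simp add: algebra_simps)
  then have "(x$i - x$j) * ?s = 0"
    unfolding gap_jk gap_ki by simp
  moreover have "?s \<noteq> 0"
    using gap_jk by (metis mult_zero_right zero_neq_one)
  ultimately show False
    using x_distinct[of i j] levi_civita_distinct[OF ijk] by simp
qed

lemma t_eq_0: "t = 0"
proof -
  have cyc: "levi_civita 1 2 3 = 1" "levi_civita 2 3 1 = 1" "levi_civita 3 1 2 = 1"
    by (simp_all add: levi_civita_eq_1_iff)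
  have pair: "t$i = 0 \<or> t$j = 0" if "levi_civita i j k = 1" "t$k = 0" for i j k
    using coupling_equation[OF that(1)] that(2) x_distinct[of i j] levi_civita_distinct[OF that(1)] by auto
  have "t$1 = 0 \<and> t$2 = 0 \<and> t$3 = 0"
    using some_coefficient_vanishes[OF cyc(1)] pair[OF cyc(1)] pair[OF cyc(2)] pair[OF cyc(3)]
      last_coefficient_vanishes[OF cyc(1)] last_coefficient_vanishes[OF cyc(2)] last_coefficient_vanishes[OF cyc(3)]
    by blast
  then show ?thesis by (simp add: vec_eq_iff forall_3)
qed

end

section \<open>Tensors with diagonal covariants\<close>

locale diagonal_covariants =
  fixes H :: ten4
  assumes H: "H \<in> harm4"
    and d2_diagonal: "diagonal (d2 H)"
    and c3_diagonal: "diagonal (c3 H)"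
    and d2_c4_commute: "d2 H ** c4 H = c4 H ** d2 H"
begin

lemma slice_inner_d2: "i \<noteq> j \<Longrightarrow> diag_slice H i j \<bullet> diag_vec (d2 H) = 0"
  using c3_diagonal by (simp add: diagonal_def c3_def dd2_diagonal[OF d2_diagonal])

lemma slice_inner_c3:
  assumes "d2 H $ i $ i \<noteq> d2 H $ j $ j"
  shows "diag_slice H i j \<bullet> diag_vec (c3 H) = 0"
proof -
  have "d2 H $ i $ i * c4 H $ i $ j = c4 H $ i $ j * d2 H $ j $ j"
    by (simp add: d2_c4_commute flip: diagonal_mult_left[OF d2_diagonal] diagonal_mult_right[OF d2_diagonal])
  then have "c4 H $ i $ j = 0" using assms by simp
  then show ?thesis by (simp add: c4_def dd2_diagonal[OF c3_diagonal])
qed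

lemma c3_diagonal_component:
  "distinct [i, j, k] \<Longrightarrow> c3 H $ i $ i
    = H i i j j * (d2 H $ j $ j - d2 H $ i $ i) + H i i k k * (d2 H $ k $ k - d2 H $ i $ i)"
  by (simp add: c3_def dd2_diagonal_component[OF H _ d2_diagonal])

lemma slice_antisymmetric_if_two_equal:
  assumes ijk: "distinct [i, j, k]" and D: "d2 H $ i $ i = d2 H $ j $ j" "d2 H $ k $ k \<noteq> d2 H $ i $ i"
    and "p \<noteq> q"
  shows "H p q k k = 0" "H p q j j = - H p q i i"
proof -
  have sum: "H p q i i + H p q j j + H p q k k = 0"
    using diag_slice_inner_1[OF H, of p q]
    by (simp add: inner_vec_def sum_distinct_3[OF ijk] diag_slice_nth)
  have "H p q i i * d2 H $ i $ i + H p q j j * d2 H $ i $ i + H p q k k * d2 H $ k $ k = 0"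
    using slice_inner_d2[OF \<open>p \<noteq> q\<close>] D(1)
    by (simp add: inner_vec_def sum_distinct_3[OF ijk] diag_slice_nth diag_vec_nth)
  then have "H p q k k * (d2 H $ k $ k - d2 H $ i $ i) = 0"
    using sum by algebra
  then show "H p q k k = 0" "H p q j j = - H p q i i"
    using D(2) sum by auto
qed

lemma mixed_slice_vanishes_if_two_equal:
  assumes ijk: "distinct [i, j, k]" and D: "d2 H $ i $ i = d2 H $ j $ j" "d2 H $ k $ k \<noteq> d2 H $ i $ i"
    and C: "c3 H $ i $ i \<noteq> c3 H $ j $ j" and pq: "d2 H $ p $ p \<noteq> d2 H $ q $ q"
  shows "diag_slice H p q = 0"
proof -
  have "p \<noteq> q" using pq by auto
  note slice = slice_antisymmetric_if_two_equal[OF ijk D \<open>p \<noteq> q\<close>]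
  have "H p q i i * (c3 H $ i $ i - c3 H $ j $ j) = 0"
    using slice_inner_c3[OF pq] slice
    by (simp add: inner_vec_def sum_distinct_3[OF ijk] diag_slice_nth diag_vec_nth algebra_simps)
  then show ?thesis
    using C slice by (simp add: vec_eq_iff all_distinct_3[OF ijk] diag_slice_nth)
qed

lemma slices_vanish_if_two_equal:
  assumes ijk: "distinct [i, j, k]" and D: "d2 H $ i $ i = d2 H $ j $ j" "d2 H $ k $ k \<noteq> d2 H $ i $ i"
    and C: "c3 H $ i $ i \<noteq> c3 H $ j $ j" and "p \<noteq> q"
  shows "diag_slice H p q = 0"
proof -
  have "i \<noteq> j" using ijk by simp
  note slice = slice_antisymmetric_if_two_equal[OF ijk D \<open>i \<noteq> j\<close>]
    and mixed = mixed_slice_vanishes_if_two_equal[OF ijk D C]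
  have "H i k l l = 0" "H j k l l = 0" for l
    using mixed[of i k] mixed[of j k] D by (simp_all add: vec_eq_iff diag_slice_nth)
  then have "(H j j k k - H i i k k) * H i j i i = 0"
    using d2_offdiagonal_component[OF H ijk] d2_diagonal slice \<open>i \<noteq> j\<close>
    by (auto simp: diagonal_def algebra_simps)
  moreover have "H i i k k \<noteq> H j j k k"
  proof
    assume "H i i k k = H j j k k"
    then have "c3 H $ i $ i = c3 H $ j $ j"
      using c3_diagonal_component[OF ijk] c3_diagonal_component[of j i k] ijk D(1) by auto
    then show False using C by contradiction
  qed
  ultimately have "diag_slice H i j = 0"
    using slice by (simp add: vec_eq_iff all_distinct_3[OF ijk] diag_slice_nth)
  moreover have "p \<in> {i, j, k}" "q \<in> {i, j, k}"
    using UNIV_eq_distinct_3[OF ijk] by blast+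
  then have "{p, q} = {i, j} \<or> d2 H $ p $ p \<noteq> d2 H $ q $ q"
    using \<open>p \<noteq> q\<close> D by auto
  ultimately show ?thesis
    using mixed[of p q] diag_slice_commute[OF H, of i j] by (auto simp: doubleton_eq_iff)
qed

lemma axis_values_quadratic:
  assumes x: "x \<bullet> 1 = 0" "\<And>i. d2 H $ i $ i = x$i + \<mu>" "\<And>i j. i \<noteq> j \<Longrightarrow> x$i \<noteq> x$j"
    and C: "(x \<times> 1) \<bullet> diag_vec (c3 H) = 0"
  obtains \<kappa> \<rho> where "\<And>i j k. levi_civita i j k = 1 \<Longrightarrow> H i i j j = \<kappa> * (x$k)\<^sup>2 + \<rho>"
proof -
  define m :: vec3 where "m = vector [H 2 2 3 3, H 3 3 1 1, H 1 1 2 2]"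
  define s :: vec3 where "s = (\<chi> k. (x$k)\<^sup>2)"
  have x3: "x$3 = - x$1 - x$2"
    using x(1) by (simp add: inner_vec_def sum_3)
  have "s \<times> 1 \<noteq> 0"
  proof
    assume "s \<times> 1 = 0"
    then have "(s \<times> 1) $ 3 = 0" "(s \<times> 1) $ 1 = 0" by simp_all
    then have "(x$1)\<^sup>2 = (x$2)\<^sup>2" "(x$2)\<^sup>2 = (x$3)\<^sup>2"
      by (simp_all add: s_def cross_components)
    then have "x$1 = - x$2" "x$2 = - x$3"
      using x(3)[of 1 2] x(3)[of 2 3] unfolding power2_eq_iff by simp_all
    then have "x$1 = 0" "x$2 = 0" using x3 by linarith+
    then show False
      using x(3)[of 1 2] by simp
  qed
  moreover have "m \<bullet> (s \<times> 1) = 0"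
  proof -
    have "distinct [1::3, 2, 3]" "distinct [2::3, 3, 1]" "distinct [3::3, 1, 2]" by auto
    note c3_components = this[THEN c3_diagonal_component]
    have "(x \<times> 1) \<bullet> diag_vec (c3 H) = - 3 * (m \<bullet> (s \<times> 1))"
      unfolding m_def s_def inner_vec_def sum_3 diag_vec_nth c3_components x(2) cross_components x3
      by (simp add: harm4_sym[OF H] x3 algebra_simps power2_eq_square)
    then show ?thesis using C by simp
  qed
  ultimately obtain \<kappa> \<rho> where m: "m = \<kappa> *\<^sub>R s + \<rho> *\<^sub>R 1"
    by (rule orthogonal_cross3_imp_combination)
  have "H i i j j = \<kappa> * (x$k)\<^sup>2 + \<rho>" if "levi_civita i j k = 1" for i j k
  proof -
    have "m $ k = H i i j j" using that by (auto simp: levi_civita_eq_1_iff m_def)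
    then show ?thesis by (simp add: m s_def)
  qed
  then show ?thesis by (rule that)
qed

lemma slice_multiple_of_cross3:
  assumes "x \<times> 1 \<noteq> 0" "\<And>i. d2 H $ i $ i = x$i + \<mu>" "i \<noteq> j"
  obtains s where "diag_slice H i j = s *\<^sub>R (x \<times> 1)"
proof -
  have "x = diag_vec (d2 H) - \<mu> *\<^sub>R 1"
    using assms(2) by (simp add: vec_eq_iff diag_vec_nth)
  then have "diag_slice H i j \<bullet> x = 0"
    by (simp add: inner_diff_right slice_inner_d2[OF \<open>i \<noteq> j\<close>] diag_slice_inner_1[OF H])
  then show ?thesis
    using that orthogonal_imp_cross3_multiple[OF assms(1) _ diag_slice_inner_1[OF H]] by blast
qed

lemma slices_vanish_if_distinct:
  assumes distinct: "\<And>i j. i \<noteq> j \<Longrightarrow> d2 H $ i $ i \<noteq> d2 H $ j $ j"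
    and "i \<noteq> j"
  shows "diag_slice H i j = 0"
proof -
  define \<mu> where "\<mu> = (diag_vec (d2 H) \<bullet> 1) / 3"
  define x where "x = diag_vec (d2 H) - \<mu> *\<^sub>R 1"
  have x: "x \<bullet> 1 = 0" "d2 H $ i $ i = x$i + \<mu>" "i \<noteq> j \<Longrightarrow> x$i \<noteq> x$j" for i j
    using distinct[of i j] by (simp_all add: x_def \<mu>_def inner_vec_def sum_3 diag_vec_nth field_simps)
  have "x \<times> 1 \<noteq> 0"
    using cross3_one_component[of 1 2 3 x] x(3)[of 1 2] by (auto simp: levi_civita_eq_1_iff)
  have "\<exists>s. diag_slice H i j = s *\<^sub>R (x \<times> 1)" if "i \<noteq> j" for i j
    using slice_multiple_of_cross3[OF \<open>x \<times> 1 \<noteq> 0\<close> x(2) that] by blast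
  then obtain s where s: "\<And>i j. i \<noteq> j \<Longrightarrow> diag_slice H i j = s i j *\<^sub>R (x \<times> 1)"
    by metis
  show ?thesis
  proof (cases "(x \<times> 1) \<bullet> diag_vec (c3 H) = 0")
    case False
    then show ?thesis
      using slice_inner_c3[OF distinct[OF \<open>i \<noteq> j\<close>]] s[OF \<open>i \<noteq> j\<close>] by simp
  next
    case True
    obtain \<kappa> \<rho> where quadratic: "\<And>i j k. levi_civita i j k = 1 \<Longrightarrow> H i i j j = \<kappa> * (x$k)\<^sup>2 + \<rho>"
      using axis_values_quadratic[OF x True] by blast
    define t :: vec3 where "t = vector [s 2 3, s 3 1, s 1 2]"
    have slice: "diag_slice H i j = t$k *\<^sub>R (x \<times> 1)" if "levi_civita i j k = 1" for i j k
      using that by (auto simp: levi_civita_eq_1_iff t_def s)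
    interpret collinear_slices H x t \<kappa> \<rho> \<mu>
      by unfold_locales (use H d2_diagonal x quadratic slice in auto)
    obtain k where "levi_civita i j k = 1 \<or> levi_civita j i k = 1"
      using \<open>i \<noteq> j\<close> exhaust_3[of i] exhaust_3[of j] by (auto simp: levi_civita_eq_1_iff)
    then show ?thesis
      using slice t_eq_0 diag_slice_commute[OF H, of i j] by auto
  qed
qed

lemma slices_vanish:
  assumes sep: "separates_axes {d2 H, c3 H}" and "p \<noteq> q"
  shows "diag_slice H p q = 0"
proof (cases "\<forall>i j. i \<noteq> j \<longrightarrow> d2 H $ i $ i \<noteq> d2 H $ j $ j")
  case True
  then show ?thesis using slices_vanish_if_distinct \<open>p \<noteq> q\<close> by blast
next
  case False
  then obtain i j where ij: "i \<noteq> j" "d2 H $ i $ i = d2 H $ j $ j" by blast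
  then have C: "c3 H $ i $ i \<noteq> c3 H $ j $ j"
    using sep by (auto simp: separates_axes_def)
  obtain k where ijk: "distinct [i, j, k]" using ij(1) by (rule obtain_third_index)
  have "d2 H $ k $ k \<noteq> d2 H $ i $ i"
    using C ij c3_diagonal_component[OF ijk] c3_diagonal_component[of j i k] ijk by auto
  then show ?thesis
    using slices_vanish_if_two_equal[OF ijk ij(2) _ C \<open>p \<noteq> q\<close>] by blast
qed

end

lemma symgrp4_eq_D2_of_d2_c3:
  assumes H: "H \<in> harm4" and pair: "symgrp2_set {d2 H, c3 H} = D2" and v6: "v6 H = 0"
  shows "symgrp4 H = D2"
proof -
  have diag: "diagonal (d2 H)" "diagonal (c3 H)" and sep: "separates_axes {d2 H, c3 H}"
    using pair unfolding symgrp2_set_eq_D2_iff by auto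
  interpret diagonal_covariants H
    by unfold_locales (use H diag v6 in \<open>simp_all add: v6_eq_0_iff\<close>)
  show ?thesis
    using slices_vanish[OF sep]
    by (intro symgrp4_eq_D2I[OF H _ pair]) (simp_all add: d2_in_Cov2 c3_in_Cov2)
qed

section \<open>The equivalences in an arbitrary frame\<close>

lemma symgrp4_eq_symgrp2_set_Cov2:
  assumes "H \<in> harm4" "orthotropic (symgrp2_set (Cov2 H))"
  shows "symgrp4 H = symgrp2_set (Cov2 H)"
  by (rule orthotropic_imp_eq_in_frame[OF frame_equivariant_Cov2[THEN frame_equivariant_symgrp2_set]
        frame_equivariant_symgrp4 assms])
    (simp add: symgrp4_eq_D2_of_Cov2 act4_harm4 SO3_orthogonal assms(1))

lemma symgrp2_set_d2_c3_eq_symgrp4: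
  assumes "H \<in> harm4" "orthotropic (symgrp4 H)"
  shows "symgrp2_set {d2 H, c3 H} = symgrp4 H"
  by (rule orthotropic_imp_eq_in_frame[OF frame_equivariant_symgrp4
        frame_equivariant_d2_c3[THEN frame_equivariant_symgrp2_set] assms])
    (simp add: symgrp2_set_d2_c3_eq_D2 act4_harm4 SO3_orthogonal assms(1))

lemma symgrp4_eq_symgrp2_set_d2_c3:
  assumes "H \<in> harm4" "orthotropic (symgrp2_set {d2 H, c3 H})" "v6 H = 0"
  shows "symgrp4 H = symgrp2_set {d2 H, c3 H}"
  by (rule orthotropic_imp_eq_in_frame[OF frame_equivariant_d2_c3[THEN frame_equivariant_symgrp2_set]
        frame_equivariant_symgrp4 assms(1,2)])
    (simp add: symgrp4_eq_D2_of_d2_c3 act4_harm4 SO3_orthogonal v6_act4_eq_0_iff assms(1,3))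

lemma v5_v6_eq_0:
  assumes "H \<in> harm4" "orthotropic (symgrp2_set {d2 H, c3 H, c4 H})"
  shows "v5 H = 0" "v6 H = 0"
  using orthotropic_symgrp2_set_commute[OF assms(2)] by (simp_all add: v5_eq_0_iff v6_eq_0_iff assms(1))

theorem theorem9p11:
  fixes H :: ten4
  assumes "H \<in> harm4"
  shows "(orthotropic (symgrp2_set (Cov2 H)) \<longleftrightarrow> orthotropic (symgrp4 H))
       \<and> (orthotropic (symgrp4 H) \<longleftrightarrow>
            v5 H = 0 \<and> v6 H = 0 \<and> orthotropic (symgrp2_set {d2 H, c3 H}))
       \<and> (orthotropic (symgrp4 H) \<longrightarrow>
            symgrp4 H = symgrp2_set {d2 H, c3 H, c4 H})"
proof -
  have "symgrp4 H \<subseteq> symgrp2_set (Cov2 H)"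
    "symgrp2_set (Cov2 H) \<subseteq> symgrp2_set {d2 H, c3 H, c4 H}"
    "symgrp2_set {d2 H, c3 H, c4 H} \<subseteq> symgrp2_set {d2 H, c3 H}"
    using symgrp4_subset_symgrp2_set[OF assms subset_refl]
    by (auto intro!: symgrp2_set_antimono d2_in_Cov2 c3_in_Cov2 c4_in_Cov2)
  then have groups_eq: "symgrp2_set (Cov2 H) = symgrp4 H" "symgrp2_set {d2 H, c3 H, c4 H} = symgrp4 H"
    if "orthotropic (symgrp4 H)"
    using symgrp2_set_d2_c3_eq_symgrp4[OF assms that] by simp_all
  then have "v5 H = 0 \<and> v6 H = 0" if "orthotropic (symgrp4 H)"
    using v5_v6_eq_0[OF assms] that by simp
  then show ?thesis
    using groups_eq symgrp4_eq_symgrp2_set_Cov2[OF assms] symgrp2_set_d2_c3_eq_symgrp4[OF assms]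
      symgrp4_eq_symgrp2_set_d2_c3[OF assms] by metis
qed

end
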